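(* For every $\varepsilon\in(0,\frac12)$ and every function $s(n)\le 2^{\tilde{O}(n^{4/5})}$, there is a monotone function $f:\{0,1\}^n\to\{\pm1\}$ computable by a decision tree of size $s$ such that the $\varepsilon$-approximator of $f$ built by any impurity-based top-down heuristic (for any impurity function, and any tie-breaking) must have size $s^{\tilde{\Omega}((\log s)^{1/4})}$.
   Context: $f$ is monotone if $f(x)\le f(y)$ whenever $x_i\le y_i$ for all $i$. Decision tree size is the number of leaves; logarithms base 2. A bare tree is a decision tree with unlabeled leaves; for a leaf $\ell$, $f_\ell$ is the restriction of $f$ by the path to $\ell$ and $|\ell|$ its depth, so a uniform $\mathbf{x}\in\{0,1\}^n$ reaches $\ell$ with probability $2^{-|\ell|}$. An impurity function is a concave $\mathscr{G}:[0,1]\to[0,1]$, symmetric about $\frac12$, with $\mathscr{G}(0)=\mathscr{G}(1)=0$ and $\mathscr{G}(\frac12)=1$. For a bare tree $T^\circ$ let $\mathcal{H}(T^\circ)=\sum_{\ell}2^{-|\ell|}\mathscr{G}(p_\ell)$, where $p_\ell=\Pr_{\mathbf{x}}[f_\ell(\mathbf{x})=1]$. Writing $T^\circ_{\ell,i}$ for $T^\circ$ with leaf $\ell$ replaced by a query to $x_i$, an impurity-based top-down heuristic starts from the one-leaf bare tree and repeatedly replaces $T^\circ$ by $T^\circ_{\ell^\star,i^\star}$, where $(\ell^\star,i^\star)$ maximizes $\mathcal{H}(T^\circ)-\mathcal{H}(T^\circ_{\ell,i})$, stopping once the $f$-completion of $T^\circ$ (label each leaf $\ell$ by $\mathrm{sign}(\mathbb{E}[f_\ell])$)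 satisfies $\Pr_{\mathbf{x}}[T(\mathbf{x})\ne f(\mathbf{x})]\le\varepsilon$; that completion is the $\varepsilon$-approximator it builds.
   Formalization: The heuristic may only make splits with strictly positive impurity gain; with zero-gain splits and any tie-breaking the claim fails (e.g. impurity equal to 1 on (0,1)). For strictly concave impurity functions nothing changes. *)

theory Defs
  imports "HOL-Probability.Probability"
begin

section \<open>Boolean functions on the cube\<close>

definition cube :: "nat \<Rightarrow> (nat \<Rightarrow> bool) set" where
  "cube n = PiE {..<n} (\<lambda>_. UNIV)"

definition unif :: "nat \<Rightarrow> (nat \<Rightarrow> bool) pmf" where
  "unif n = pmf_of_set (cube n)"

definition sign_valued :: "nat \<Rightarrow> ((nat \<Rightarrow> bool) \<Rightarrow> real) \<Rightarrow> bool" where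
  "sign_valued n f \<longleftrightarrow> (\<forall>x\<in>cube n. f x \<in> {-1, 1})"

definition monotone_fun :: "nat \<Rightarrow> ((nat \<Rightarrow> bool) \<Rightarrow> real) \<Rightarrow> bool" where
  "monotone_fun n f \<longleftrightarrow>
     (\<forall>x\<in>cube n. \<forall>y\<in>cube n. (\<forall>i<n. x i \<le> y i) \<longrightarrow> f x \<le> f y)"

text \<open>A leaf is addressed by its path: the list of (queried variable, answer) pairs
  from the root.  A restriction is kept as a function of all variables that ignores the
  restricted ones, so its probabilities and expectations may be taken over the whole cube.\<close>

type_synonym path = "(nat \<times> bool) list"

fun restrict_path :: "((nat \<Rightarrow> bool) \<Rightarrow> real) \<Rightarrow> path \<Rightarrow> (nat \<Rightarrow> bool) \<Rightarrow> real" where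
  "restrict_path f [] = f"
| "restrict_path f ((i, b) # \<pi>) = restrict_path (\<lambda>x. f (x(i := b))) \<pi>"


section \<open>Decision trees\<close>

datatype 'a dtree = Leaf 'a | Query nat "'a dtree" "'a dtree"

type_synonym bare_tree = "unit dtree"

text \<open>The second subtree of a query is the one followed when the variable is 1.\<close>

fun run_tree :: "'a dtree \<Rightarrow> (nat \<Rightarrow> bool) \<Rightarrow> 'a" where
  "run_tree (Leaf a) x = a"
| "run_tree (Query i l r) x = (if x i then run_tree r x else run_tree l x)"

fun tree_size :: "'a dtree \<Rightarrow> nat" where
  "tree_size (Leaf a) = 1"
| "tree_size (Query i l r) = tree_size l + tree_size r"

fun leaf_paths :: "'a dtree \<Rightarrow> path set" where
  "leaf_paths (Leaf a) = {[]}"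
| "leaf_paths (Query i l r) = Cons (i, False) ` leaf_paths l \<union> Cons (i, True) ` leaf_paths r"

text \<open>No variable is queried twice on a path; this is what makes the probability of
  reaching a leaf two to the minus its depth.\<close>

fun tree_over :: "nat set \<Rightarrow> 'a dtree \<Rightarrow> bool" where
  "tree_over V (Leaf a) = True"
| "tree_over V (Query i l r) = (i \<in> V \<and> tree_over (V - {i}) l \<and> tree_over (V - {i}) r)"

definition computable_with_size :: "nat \<Rightarrow> ((nat \<Rightarrow> bool) \<Rightarrow> real) \<Rightarrow> nat \<Rightarrow> bool" where
  "computable_with_size n f s \<longleftrightarrow>
     (\<exists>T. tree_over {..<n} T \<and> tree_size T \<le> s \<and> (\<forall>x\<in>cube n. run_tree T x = f x))"

text \<open>A leaf on which the restriction has mean zero gets label 1; either label gives the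
  same error and the same size.\<close>

fun completion :: "nat \<Rightarrow> ((nat \<Rightarrow> bool) \<Rightarrow> real) \<Rightarrow> bare_tree \<Rightarrow> real dtree" where
  "completion n f (Leaf u) =
     Leaf (if measure_pmf.expectation (unif n) f \<ge> 0 then 1 else -1)"
| "completion n f (Query i l r) =
     Query i (completion n (\<lambda>x. f (x(i := False))) l) (completion n (\<lambda>x. f (x(i := True))) r)"

definition tree_error :: "nat \<Rightarrow> ((nat \<Rightarrow> bool) \<Rightarrow> real) \<Rightarrow> real dtree \<Rightarrow> real" where
  "tree_error n f T = measure_pmf.prob (unif n) {x. run_tree T x \<noteq> f x}"


section \<open>Impurity-based top-down heuristics\<close>

definition impurity_function :: "(real \<Rightarrow> real) \<Rightarrow> bool" where
  "impurity_function G \<longleftrightarrow>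
     (\<forall>p\<in>{0..1}. G p \<in> {0..1}) \<and> concave_on {0..1} G \<and>
     (\<forall>p\<in>{0..1}. G (1 - p) = G p) \<and> G 0 = 0 \<and> G 1 = 0 \<and> G (1/2) = 1"

definition tree_impurity ::
  "(real \<Rightarrow> real) \<Rightarrow> nat \<Rightarrow> ((nat \<Rightarrow> bool) \<Rightarrow> real) \<Rightarrow> bare_tree \<Rightarrow> real" where
  "tree_impurity G n f T =
     (\<Sum>\<pi>\<in>leaf_paths T. (1/2) ^ length \<pi> *
        G (measure_pmf.prob (unif n) {x. restrict_path f \<pi> x = 1}))"

text \<open>Replaces the leaf addressed by the path by a query to the given variable (and leaves
  the tree unchanged if the path does not address a leaf).\<close>

fun split_leaf :: "bare_tree \<Rightarrow> path \<Rightarrow> nat \<Rightarrow> bare_tree" where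
  "split_leaf (Leaf u) [] i = Query i (Leaf ()) (Leaf ())"
| "split_leaf (Leaf u) (e # \<pi>) i = Leaf u"
| "split_leaf (Query j l r) [] i = Query j l r"
| "split_leaf (Query j l r) ((k, b) # \<pi>) i =
     (if k \<noteq> j then Query j l r
      else if b then Query j l (split_leaf r \<pi> i) else Query j (split_leaf l \<pi> i) r)"

definition splits :: "nat \<Rightarrow> bare_tree \<Rightarrow> (path \<times> nat) set" where
  "splits n T = {(\<pi>, i). \<pi> \<in> leaf_paths T \<and> i < n \<and> i \<notin> fst ` set \<pi>}"

definition gain ::
  "(real \<Rightarrow> real) \<Rightarrow> nat \<Rightarrow> ((nat \<Rightarrow> bool) \<Rightarrow> real) \<Rightarrow> bare_tree \<Rightarrow> path \<times> nat \<Rightarrow> real" where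
  "gain G n f T = (\<lambda>(\<pi>, i). tree_impurity G n f T - tree_impurity G n f (split_leaf T \<pi> i))"

text \<open>The bare trees occurring in the runs of the heuristic, over all ways of breaking ties.
  A split must have positive gain.  If \<open>G\<close> is strictly concave and \<open>f\<close> monotone, a maximizing split
  always has, as long as some leaf is not constant.  For impurity functions with affine pieces
  all gains can vanish before the target error is reached, and the condition cannot be
  dropped: with \<open>G p = 1\<close> for \<open>0 < p < 1\<close>, ties among splits of gain zero can be
  broken so as to follow an optimal tree, and the completion then has size at most
  \<open>2 * s * n + 1\<close>.\<close>

inductive reachable ::
  "(real \<Rightarrow> real) \<Rightarrow> real \<Rightarrow> nat \<Rightarrow> ((nat \<Rightarrow> bool) \<Rightarrow> real) \<Rightarrow> bare_tree \<Rightarrow> bool"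
  for G \<epsilon> n f where
  start: "reachable G \<epsilon> n f (Leaf ())"
| step: "reachable G \<epsilon> n f (split_leaf T \<pi> i)"
    if "reachable G \<epsilon> n f T" and "\<not> tree_error n f (completion n f T) \<le> \<epsilon>"
      and "(\<pi>, i) \<in> splits n T" and "\<forall>e\<in>splits n T. gain G n f T e \<le> gain G n f T (\<pi>, i)"
      and "gain G n f T (\<pi>, i) > 0"

definition builds ::
  "(real \<Rightarrow> real) \<Rightarrow> real \<Rightarrow> nat \<Rightarrow> ((nat \<Rightarrow> bool) \<Rightarrow> real) \<Rightarrow> real dtree \<Rightarrow> bool" where
  "builds G \<epsilon> n f T \<longleftrightarrow>
     (\<exists>B. reachable G \<epsilon> n f B \<and> T = completion n f B \<and> tree_error n f T \<le> \<epsilon>)"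


section \<open>Asymptotic notation up to polylogarithmic factors\<close>

definition soft_O :: "(nat \<Rightarrow> real) \<Rightarrow> (nat \<Rightarrow> real) set" where
  "soft_O g = {h. \<exists>C>0. \<exists>k::nat. eventually (\<lambda>m. h m \<le> C * g m * (log 2 (g m)) ^ k) at_top}"

definition soft_Omega :: "(nat \<Rightarrow> real) \<Rightarrow> (nat \<Rightarrow> real) set" where
  "soft_Omega g = {h. \<exists>c>0. \<exists>k::nat. eventually (\<lambda>m. h m \<ge> c * g m / (log 2 (g m)) ^ k) at_top}"

end

theory Submission
  imports Defs "HOL-Real_Asymp.Real_Asymp"
begin

text \<open>For a monotone function, concavity of the impurity function forces every split of positive
  gain to query a most influential variable, so only greedy trees matter.

  The hard function has disjoint conjunctions of width \<open>w\<close> over the first variables and \<open>B\<close> further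
  blocks of \<open>m\<close> variables.  If exactly one conjunction holds, it selects a block, and the value is the
  majority of that block; otherwise the number of true conjunctions decides.  An optimal tree reads
  the conjunctions and then a single block.  But a conjunction variable has influence of order
  \<open>2^-w\<close>, much less than a variable of a block whose answers so far are balanced, so the greedy tree
  goes on reading all the blocks.  A second moment argument shows that on a typical path
  it must ask a constant fraction of all \<open>B * m\<close> block variables before the blocks become so
  unbalanced that a conjunction variable is preferred.  Without the conjunction variables nothing is
  learnt about \<open>f\<close>, since the majorities of the many blocks average out.\<close>

section \<open>Averages over the cube\<close>

text \<open>Put \<kappa> = 1/2 - \<epsilon> and lm = log s. The scales, up to logarithms, are 2^w
  and m of order lm and B of order lm^(1/4), with D of order 2^w. All terms plus one block cost D*w
  + m <= lm bits, while the greedy tree is driven to a depth d of order \<kappa>*B*m, so the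
  exponent grows by the factor B. A block variable has influence of order q*(D/B)/sqrt m against
  order q for a term variable, so the comparison asks only that D/B be large against sqrt m. What
  fixes B is the supply of variables, B*m <= n: this is where log s <= n^(4/5) meets the exponent
  1/4. Size is measured through one event, that a uniform input meets a term variable in the tree.
  Since an error of at most 1/2 - \<kappa> is impossible without term variables, the event has
  probability at least 3\<kappa>/4. Greediness bounds it by size/2^d + 1/K: either the path is d
  long, or the potential \<Phi> has grown to K times its expected size. The choice K = 4/\<kappa>
  leaves size >= (\<kappa>/2)*2^d.\<close>

lemma finite_cube: "finite (cube n)"
  unfolding cube_def by (intro finite_PiE) auto

lemma card_cube: "card (cube n) = 2 ^ n"
  unfolding cube_def by (simp add: card_PiE)

lemma cube_nonempty: "cube n \<noteq> {}"
  using card_cube[of n] by auto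

definition mean :: "nat \<Rightarrow> ((nat \<Rightarrow> bool) \<Rightarrow> real) \<Rightarrow> real" where
  "mean n g = (\<Sum>x\<in>cube n. g x) / 2 ^ n"

lemma prob_unif: "measure_pmf.prob (unif n) {x. P x} = mean n (\<lambda>x. of_bool (P x))"
  unfolding unif_def mean_def
  by (subst measure_pmf_of_set)
     (auto simp: finite_cube cube_nonempty card_cube of_bool_def sum.If_cases)

lemma mean_add: "mean n (\<lambda>x. g x + h x) = mean n g + mean n h"
  by (simp add: mean_def sum.distrib add_divide_distrib)

lemma mean_diff: "mean n (\<lambda>x. g x - h x) = mean n g - mean n h"
  by (simp add: mean_def sum_subtractf diff_divide_distrib)

lemma mean_cmult: "mean n (\<lambda>x. c * g x) = c * mean n g"
  by (simp add: mean_def sum_distrib_left)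

lemma mean_sum: "mean n (\<lambda>x. \<Sum>a\<in>A. g a x) = (\<Sum>a\<in>A. mean n (g a))"
  unfolding mean_def by (subst sum.swap) (simp add: sum_divide_distrib)

lemma mean_const: "mean n (\<lambda>x. c) = c"
  by (simp add: mean_def card_cube)

lemma mean_mono: "(\<And>x. x \<in> cube n \<Longrightarrow> g x \<le> h x) \<Longrightarrow> mean n g \<le> mean n h"
  unfolding mean_def by (intro divide_right_mono sum_mono) auto

lemma mean_cong: "(\<And>x. x \<in> cube n \<Longrightarrow> g x = h x) \<Longrightarrow> mean n g = mean n h"
  unfolding mean_def by (intro arg_cong2[where f = "(/)"] sum.cong) auto

lemma mean_0: "mean 0 g = g (\<lambda>_. undefined)"
  by (simp add: mean_def cube_def)

lemma mean_Suc:
  "mean (Suc n) g = (mean n (\<lambda>x. g (x(n := False))) + mean n (\<lambda>x. g (x(n := True)))) / 2"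
proof -
  have "(\<Sum>x\<in>cube (Suc n). g x) = (\<Sum>(b, x)\<in>UNIV \<times> cube n. g (x(n := b)))"
    unfolding cube_def lessThan_Suc
    by (subst PiE_insert_eq, subst sum.reindex[OF inj_combinator]) (auto simp: case_prod_unfold)
  also have "\<dots> = (\<Sum>x\<in>cube n. g (x(n := False))) + (\<Sum>x\<in>cube n. g (x(n := True)))"
    by (subst sum.cartesian_product[symmetric]) (simp add: UNIV_bool)
  finally show ?thesis by (simp add: mean_def add_divide_distrib)
qed

lemma mean_split:
  assumes "i < n"
  shows "mean n g = (mean n (\<lambda>x. g (x(i := False))) + mean n (\<lambda>x. g (x(i := True)))) / 2"
  using assms
proof (induction n arbitrary: g)
  case (Suc n)
  show ?case
  proof (cases "i = n")
    case True
    show ?thesis unfolding True mean_Suc fun_upd_upd by simp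
  next
    case False
    then have "i < n" using Suc.prems by simp
    have "(x(n := b))(i := c) = (x(i := c))(n := b)" for x :: "nat \<Rightarrow> bool" and b c
      using False by (simp add: fun_upd_twist)
    then show ?thesis
      unfolding mean_Suc Suc.IH[OF \<open>i < n\<close>, of "\<lambda>x. g (x(n := b))" for b] by (simp add: field_simps)
  qed
qed simp

section \<open>Functions of few variables and independence\<close>

definition depends_on :: "nat set \<Rightarrow> ((nat \<Rightarrow> bool) \<Rightarrow> 'a) \<Rightarrow> bool" where
  "depends_on V g \<longleftrightarrow> (\<forall>x y. (\<forall>i\<in>V. x i = y i) \<longrightarrow> g x = g y)"

lemma depends_onD: "depends_on V g \<Longrightarrow> (\<And>i. i \<in> V \<Longrightarrow> x i = y i) \<Longrightarrow> g x = g y"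
  unfolding depends_on_def by blast

lemma depends_on_fun_upd: "depends_on V g \<Longrightarrow> i \<notin> V \<Longrightarrow> g (x(i := b)) = g x"
  by (erule depends_onD) auto

lemma depends_on_upd: "depends_on V g \<Longrightarrow> depends_on V (\<lambda>x. g (x(i := b)))"
  unfolding depends_on_def by auto

lemma depends_on_mono: "depends_on V g \<Longrightarrow> V \<subseteq> W \<Longrightarrow> depends_on W g"
  unfolding depends_on_def by blast

lemma depends_on_comp: "depends_on V g \<Longrightarrow> depends_on V (\<lambda>x. h (g x))"
  unfolding depends_on_def by (intro allI impI arg_cong[where f = h]) blast

text \<open>Induction on the last coordinate: by disjointness at most one factor depends on it, so
  the other passes through the average unchanged.\<close>

lemma mean_mult_indep:
  assumes "depends_on V g" "depends_on W h" "V \<inter> W = {}"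
  shows "mean n (\<lambda>x. g x * h x) = mean n g * mean n h"
  using assms
proof (induction n arbitrary: g h)
  case (Suc n)
  show ?case
  proof (cases "n \<in> V")
    case True
    then have "n \<notin> W" using Suc.prems by auto
    have "mean n (\<lambda>x. g (x(n := b)) * h x) = mean n (\<lambda>x. g (x(n := b))) * mean n h" for b
      by (intro Suc.IH depends_on_upd Suc.prems)
    then show ?thesis
      unfolding mean_Suc depends_on_fun_upd[OF Suc.prems(2) \<open>n \<notin> W\<close>] by (simp add: field_simps)
  next
    case False
    have "mean n (\<lambda>x. g x * h (x(n := b))) = mean n g * mean n (\<lambda>x. h (x(n := b)))" for b
      by (intro Suc.IH depends_on_upd Suc.prems)
    then show ?thesis
      unfolding mean_Suc depends_on_fun_upd[OF Suc.prems(1) False] by (simp add: field_simps)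
  qed
qed (simp add: mean_0)

text \<open>Fixing one variable of \<open>R\<close> shifts the count by 0 or 1, so the two halves
  combine by Pascal's rule.\<close>

lemma mean_card_eq:
  assumes "finite R" "R \<subseteq> {..<n}"
  shows "mean n (\<lambda>x. of_bool (card {i\<in>R. x i} = k)) = (card R choose k) / 2 ^ card R"
  using assms
proof (induction R arbitrary: k rule: finite_induct)
  case empty
  then show ?case by (simp add: mean_const)
next
  case (insert j R)
  have F: "{i \<in> insert j R. (x(j := False)) i} = {i\<in>R. x i}" for x
    using insert.hyps by auto
  have T: "{i \<in> insert j R. (x(j := True)) i} = insert j {i\<in>R. x i}" for x
    using insert.hyps by auto
  have cT: "card (insert j {i\<in>R. x i}) = Suc (card {i\<in>R. x i})" for x
    using insert.hyps by (subst card_insert_disjoint) auto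
  have Rn: "R \<subseteq> {..<n}" using insert.prems by simp
  have "mean n (\<lambda>x. of_bool (card {i \<in> insert j R. x i} = k)) =
     (mean n (\<lambda>x. of_bool (card {i\<in>R. x i} = k)) + mean n (\<lambda>x. of_bool (Suc (card {i\<in>R. x i}) = k))) / 2"
    using insert.prems
    by (subst mean_split[where i = j]) (auto simp only: F T cT insert_subset lessThan_iff)
  also have "\<dots> = (card (insert j R) choose k) / 2 ^ card (insert j R)"
  proof (cases k)
    case 0
    show ?thesis unfolding 0 insert.IH[OF Rn] using insert.hyps by (simp add: mean_const)
  next
    case (Suc l)
    show ?thesis unfolding Suc nat.inject insert.IH[OF Rn] using insert.hyps by (simp add: field_simps)
  qed
  finally show ?case .
qed

lemma mean_all_ones:
  assumes "R \<subseteq> {..<n}"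
  shows "mean n (\<lambda>z. of_bool (\<forall>i\<in>R. z i)) = 1 / 2 ^ card R"
proof -
  have fin: "finite R" using assms finite_subset by blast
  have "(\<forall>i\<in>R. z i) \<longleftrightarrow> card {i\<in>R. z i} = card R" for z
  proof
    assume "card {i\<in>R. z i} = card R"
    then have "{i\<in>R. z i} = R" using fin by (intro card_subset_eq) auto
    then show "\<forall>i\<in>R. z i" by blast
  qed (auto intro: arg_cong[of _ _ card])
  then show ?thesis using mean_card_eq[OF fin assms, of "card R"] by simp
qed

text \<open>Nonnegativity of the variance.\<close>

lemma mean_square_le: "(mean n g)\<^sup>2 \<le> mean n (\<lambda>z. (g z)\<^sup>2)"
proof -
  have "0 \<le> mean n (\<lambda>z. (g z - mean n g)\<^sup>2)"
    using mean_mono[of n "\<lambda>_. 0" "\<lambda>z. (g z - mean n g)\<^sup>2"] by (simp add: mean_const)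
  also have "mean n (\<lambda>z. (g z - mean n g)\<^sup>2) =
      mean n (\<lambda>z. (g z)\<^sup>2 - (2 * mean n g) * g z + (mean n g)\<^sup>2)"
    by (intro mean_cong) (simp add: power2_eq_square algebra_simps)
  also have "\<dots> = mean n (\<lambda>z. (g z)\<^sup>2) - (mean n g)\<^sup>2"
    unfolding mean_add mean_diff mean_cmult mean_const by (simp add: power2_eq_square)
  finally show ?thesis by simp
qed

section \<open>Greedy trees\<close>

text \<open>For a monotone sign-valued \<open>g\<close> this is twice the probability that flipping
  \<open>i\<close> changes the value.\<close>

definition infl :: "nat \<Rightarrow> ((nat \<Rightarrow> bool) \<Rightarrow> real) \<Rightarrow> nat \<Rightarrow> real" where
  "infl n g i = mean n (\<lambda>x. g (x(i := True))) - mean n (\<lambda>x. g (x(i := False)))"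

definition acceptance :: "nat \<Rightarrow> ((nat \<Rightarrow> bool) \<Rightarrow> real) \<Rightarrow> real" where
  "acceptance n g = measure_pmf.prob (unif n) {x. g x = 1}"

text \<open>Required of all assignments, not only those in the cube, so that restrictions inherit it
  without side conditions.\<close>

definition sign_fun :: "((nat \<Rightarrow> bool) \<Rightarrow> real) \<Rightarrow> bool" where
  "sign_fun g \<longleftrightarrow> (\<forall>x. g x \<in> {-1, 1})"

lemma acceptance_eq_mean:
  assumes "sign_fun g"
  shows "acceptance n g = (1 + mean n g) / 2"
proof -
  have "mean n g = mean n (\<lambda>x. 2 * of_bool (g x = 1) - 1)"
    using assms unfolding sign_fun_def by (intro mean_cong) (smt (verit, best) insert_iff of_bool_eq singletonD)
  then show ?thesis
    unfolding acceptance_def prob_unif by (simp add: mean_diff mean_cmult mean_const)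
qed

lemma acceptance_bounds: "0 \<le> acceptance n g" "acceptance n g \<le> 1"
  by (auto simp: acceptance_def)

lemma restrict_path_append: "restrict_path f (\<pi> @ \<rho>) = restrict_path (restrict_path f \<pi>) \<rho>"
  by (induction f \<pi> rule: restrict_path.induct) auto

lemma sign_fun_restrict_path: "sign_fun f \<Longrightarrow> sign_fun (restrict_path f \<pi>)"
  by (induction f \<pi> rule: restrict_path.induct) (auto simp: sign_fun_def)

lemma mono_restrict_path: "mono f \<Longrightarrow> mono (restrict_path f \<pi>)"
proof (induction f \<pi> rule: restrict_path.induct)
  case (2 f i b \<pi>)
  have "mono (\<lambda>x. f (x(i := b)))"
    by (rule monoI, rule monoD[OF 2(2)]) (simp add: le_fun_def)
  then show ?case using 2(1) by simp
qed simp

lemma restrict_path_indep: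
  "(\<And>x b. f (x(i := b)) = f x) \<Longrightarrow> restrict_path f \<pi> (x(i := b)) = restrict_path f \<pi> x"
proof (induction f \<pi> rule: restrict_path.induct)
  case (2 f j c \<pi>)
  have "f (x(i := b, j := c)) = f (x(j := c))" for x b
    using 2(2) by (cases "i = j") (simp_all add: fun_upd_twist[of i j] del: fun_upd_apply)
  then show ?case using 2(1) by (simp del: fun_upd_apply)
qed simp

text \<open>A queried variable has influence 0 from then on, so it cannot be the more influential
  competitor when greediness is checked.\<close>

lemma restrict_path_queried:
  "i \<in> fst ` set \<pi> \<Longrightarrow> restrict_path f \<pi> (x(i := b)) = restrict_path f \<pi> x"
proof (induction f \<pi> rule: restrict_path.induct)
  case (2 f j c \<pi>)
  show ?case
  proof (cases "i = j")
    case True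
    then show ?thesis by (simp add: restrict_path_indep del: fun_upd_apply)
  next
    case False
    then show ?thesis using 2 by simp
  qed
qed simp

lemma infl_nonneg:
  assumes "mono g"
  shows "0 \<le> infl n g i"
  unfolding infl_def diff_ge_0_iff_ge
  by (intro mean_mono monoD[OF assms]) (simp add: le_fun_def)

lemma finite_leaf_paths: "finite (leaf_paths T)"
  by (induction T) auto

lemma tree_impurity_Leaf: "tree_impurity G n f (Leaf u) = G (acceptance n f)"
  by (simp add: tree_impurity_def acceptance_def)

lemma tree_impurity_Query:
  "tree_impurity G n f (Query j l r) =
     (tree_impurity G n (\<lambda>x. f (x(j := False))) l + tree_impurity G n (\<lambda>x. f (x(j := True))) r) / 2"
proof -
  have "Cons (j, False) ` leaf_paths l \<inter> Cons (j, True) ` leaf_paths r = {}" by auto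
  then show ?thesis
    unfolding tree_impurity_def leaf_paths.simps
    by (subst sum.union_disjoint)
       (auto simp: finite_leaf_paths sum.reindex sum_distrib_left sum_divide_distrib add_divide_distrib)
qed

text \<open>A split replaces a single summand of the impurity. The common factor is the probability
  of the leaf, so gains at one leaf compare through the acceptances alone.\<close>

lemma gain_leaf:
  "\<pi> \<in> leaf_paths T \<Longrightarrow> gain G n f T (\<pi>, i) = (1/2) ^ length \<pi> *
     (G (acceptance n (restrict_path f \<pi>)) -
      (G (acceptance n (\<lambda>x. restrict_path f \<pi> (x(i := False)))) +
       G (acceptance n (\<lambda>x. restrict_path f \<pi> (x(i := True))))) / 2)"
proof (induction T arbitrary: f \<pi>)
  case (Leaf u)
  then show ?case by (simp add: gain_def tree_impurity_Leaf tree_impurity_Query del: fun_upd_apply)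
next
  case (Query j l r)
  have *: "gain G n f (Query j l r) ((j, b) # \<rho>, i) =
      gain G n (\<lambda>x. f (x(j := b))) (if b then r else l) (\<rho>, i) / 2" for b \<rho>
    by (simp add: gain_def tree_impurity_Query diff_divide_distrib add_divide_distrib del: fun_upd_apply)
  from Query.prems obtain b \<rho> where \<rho>: "\<pi> = (j, b) # \<rho>" "\<rho> \<in> leaf_paths (if b then r else l)"
  proof (cases \<pi>)
    case (Cons e \<rho>)
    then show thesis using Query.prems that[of "snd e" \<rho>] by (cases e) (auto split: if_splits)
  qed (use Query.prems in auto)
  show ?case
    using \<rho> Query.IH(1)[of \<rho> "\<lambda>x. f (x(j := b))"] Query.IH(2)[of \<rho> "\<lambda>x. f (x(j := b))"]
    unfolding \<rho>(1) * by (cases b) (simp_all del: fun_upd_apply)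
qed

text \<open>Once a split has positive gain, concavity makes the gain at the same leaf strictly increase
  with the influence, so ties cannot favour a less influential variable.\<close>

lemma concave_gain_strict_mono:
  fixes G :: "real \<Rightarrow> real"
  assumes G: "concave_on {0..1} G" and d: "0 \<le> d" "d < d'" and p: "0 \<le> p - d'" "p + d' \<le> 1"
    and pos: "0 < G p - (G (p - d) + G (p + d)) / 2"
  shows "G p - (G (p - d) + G (p + d)) / 2 < G p - (G (p - d') + G (p + d')) / 2"
proof -
  define t where "t = d / d'"
  have t: "0 \<le> t" "t < 1" "d = t * d'" using d by (auto simp: t_def)
  have conv: "convex_on {0..1} (\<lambda>x. - G x)" using G by (simp add: concave_on_def)
  \<comment> \<open>The points \<open>p - d\<close> and \<open>p + d\<close> lie the fraction
    \<open>t\<close> of the way from \<open>p\<close> to \<open>p - d'\<close> and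
    \<open>p + d'\<close>; concavity on both segments bounds the gain for \<open>d\<close> by
    \<open>t\<close> times the gain for \<open>d'\<close>.\<close>
  have 1: "- G ((1 - t) *\<^sub>R p + t *\<^sub>R (p - d')) \<le> (1 - t) * - G p + t * - G (p - d')"
    using t d p by (intro convex_onD[OF conv]) auto
  have 2: "- G ((1 - t) *\<^sub>R p + t *\<^sub>R (p + d')) \<le> (1 - t) * - G p + t * - G (p + d')"
    using t d p by (intro convex_onD[OF conv]) auto
  have e: "(1 - t) *\<^sub>R p + t *\<^sub>R (p - d') = p - d" "(1 - t) *\<^sub>R p + t *\<^sub>R (p + d') = p + d"
    using t by (auto simp: algebra_simps)
  define g g' where "g = G p - (G (p - d) + G (p + d)) / 2" and "g' = G p - (G (p - d') + G (p + d')) / 2"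
  have "t * g' = t * G p - (t * G (p - d') + t * G (p + d')) / 2"
    by (simp add: g'_def algebra_simps)
  moreover have "G (p - d) \<ge> G p - t * G p + t * G (p - d')" "G (p + d) \<ge> G p - t * G p + t * G (p + d')"
    using 1 2 unfolding e by (simp_all add: algebra_simps)
  ultimately have "g \<le> t * g'" unfolding g_def by argo
  moreover have "0 < g" using pos by (simp add: g_def)
  ultimately have "0 < g'" using t by (smt (verit) mult_nonneg_nonpos)
  with \<open>g \<le> t * g'\<close> t have "g < g'" by (smt (verit) mult_less_cancel_right2)
  then show ?thesis by (simp add: g_def g'_def)
qed

text \<open>Keeps only the choice of variable at each node. The order in which leaves were split is
  forgotten, which makes the condition recursive on the tree.\<close>

fun greedy :: "nat \<Rightarrow> ((nat \<Rightarrow> bool) \<Rightarrow> real) \<Rightarrow> bare_tree \<Rightarrow> bool" where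
  "greedy n f (Leaf u) \<longleftrightarrow> True"
| "greedy n f (Query i l r) \<longleftrightarrow> (\<forall>j<n. infl n f j \<le> infl n f i) \<and>
     greedy n (\<lambda>x. f (x(i := False))) l \<and> greedy n (\<lambda>x. f (x(i := True))) r"

lemma greedy_split_leaf:
  "greedy n f T \<Longrightarrow> \<pi> \<in> leaf_paths T \<Longrightarrow>
     (\<And>j. j < n \<Longrightarrow> infl n (restrict_path f \<pi>) j \<le> infl n (restrict_path f \<pi>) i) \<Longrightarrow>
     greedy n f (split_leaf T \<pi> i)"
  by (induction T arbitrary: f \<pi>) auto

lemma tree_over_split_leaf:
  "tree_over V T \<Longrightarrow> \<pi> \<in> leaf_paths T \<Longrightarrow> i \<in> V \<Longrightarrow> i \<notin> fst ` set \<pi> \<Longrightarrow>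
     tree_over V (split_leaf T \<pi> i)"
  by (induction T arbitrary: V \<pi>) auto

lemma reachable_greedy:
  assumes "reachable G \<epsilon> n f T" and G: "impurity_function G" and f: "sign_fun f" "mono f"
  shows "greedy n f T \<and> tree_over {..<n} T"
  using assms(1)
proof induction
  case (step T \<pi> i)
  from step(3) have i: "\<pi> \<in> leaf_paths T" "i < n" "i \<notin> fst ` set \<pi>" by (auto simp: splits_def)
  define g where "g = restrict_path f \<pi>"
  have g: "sign_fun g" "mono g"
    unfolding g_def using f sign_fun_restrict_path mono_restrict_path by auto
  define p where "p = acceptance n g"
  \<comment> \<open>Fixing a variable moves the mean by half its influence, and acceptance is
    \<open>(1 + mean) / 2\<close>, hence the quarter.\<close>
  define d where "d = (\<lambda>j. infl n g j / 4)"
  have acc: "acceptance n (\<lambda>x. g (x(j := False))) = p - d j"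
    "acceptance n (\<lambda>x. g (x(j := True))) = p + d j" if "j < n" for j
  proof -
    have "sign_fun (\<lambda>x. g (x(j := b)))" for b using g by (simp add: sign_fun_def)
    then show "acceptance n (\<lambda>x. g (x(j := False))) = p - d j"
      "acceptance n (\<lambda>x. g (x(j := True))) = p + d j"
      using mean_split[OF that, of g]
      by (simp_all add: acceptance_eq_mean g p_def d_def infl_def field_simps)
  qed
  have gain: "gain G n f T (\<pi>, j) = (1/2) ^ length \<pi> * (G p - (G (p - d j) + G (p + d j)) / 2)"
    if "j < n" for j
    using gain_leaf[OF i(1), of G n f j] acc[OF that] by (simp add: g_def p_def)
  have "infl n g j \<le> infl n g i" if j: "j < n" for j
  proof (rule ccontr)
    assume "\<not> infl n g j \<le> infl n g i"
    then have less: "d i < d j" by (simp add: d_def)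
    have nn: "0 \<le> d i" using infl_nonneg[OF g(2)] by (simp add: d_def)
    \<comment> \<open>A variable of positive influence is still unqueried on this path, so
      \<open>(\<pi>, j)\<close> was an admissible competitor.\<close>
    have "j \<notin> fst ` set \<pi>"
    proof
      assume "j \<in> fst ` set \<pi>"
      then have "infl n g j = 0" by (simp add: infl_def g_def restrict_path_queried)
      then show False using less nn by (simp add: d_def)
    qed
    then have "(\<pi>, j) \<in> splits n T" using i j by (auto simp: splits_def)
    then have le: "gain G n f T (\<pi>, j) \<le> gain G n f T (\<pi>, i)" using step(4) by blast
    have "0 < G p - (G (p - d i) + G (p + d i)) / 2"
      using step(5) unfolding gain[OF i(2)] by (simp add: zero_less_mult_iff)
    then have "G p - (G (p - d i) + G (p + d i)) / 2 < G p - (G (p - d j) + G (p + d j)) / 2"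
      using G acceptance_bounds(1)[of n "\<lambda>x. g (x(j := False))"]
        acceptance_bounds(2)[of n "\<lambda>x. g (x(j := True))"] less nn
      unfolding acc[OF j] by (intro concave_gain_strict_mono) (auto simp: impurity_function_def)
    then show False using le unfolding gain[OF i(2)] gain[OF j] by simp
  qed
  then show ?case
    using step.IH i greedy_split_leaf[of n f T \<pi> i] tree_over_split_leaf[of "{..<n}" T \<pi> i]
    unfolding g_def by auto
qed simp

section \<open>The hard function\<close>

text \<open>Negating every coordinate leaves the extensional cube, whose points are fixed outside
  \<open>{..<n}\<close>; the dependence hypothesis hides this.\<close>

lemma mean_complement:
  "depends_on {..<n} g \<Longrightarrow> mean n (\<lambda>x. g (\<lambda>i. \<not> x i)) = mean n g"
proof (induction n arbitrary: g)
  case 0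
  then show ?case by (simp add: mean_0 depends_on_def)
next
  case (Suc n)
  have dep: "depends_on {..<n} (\<lambda>x. g (x(n := b)))" for b
    unfolding depends_on_def by (auto intro!: depends_onD[OF Suc.prems] simp: less_Suc_eq)
  have "(\<lambda>i. \<not> (x(n := b)) i) = (\<lambda>i. \<not> x i)(n := \<not> b)" for x :: "nat \<Rightarrow> bool" and b
    by auto
  then show ?case
    using Suc.IH[OF dep, of True] Suc.IH[OF dep, of False] by (simp add: mean_Suc del: fun_upd_apply)
qed

text \<open>Each complete run of \<open>B\<close> indices contributes one. This many terms select a
  given block, which bounds the influence of its variables from below.\<close>

lemma card_residue_class_ge:
  fixes B D r :: nat
  assumes "r < B"
  shows "D div B \<le> card {e. e < D \<and> e mod B = r}"
proof -
  have "(\<lambda>k. k * B + r) ` {..<D div B} \<subseteq> {e. e < D \<and> e mod B = r}"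
  proof clarify
    fix k assume "k < D div B"
    then have "Suc k * B \<le> D div B * B" by (intro mult_right_mono) auto
    also have "\<dots> \<le> D" by simp
    finally show "k * B + r < D \<and> (k * B + r) mod B = r" using assms by simp
  qed
  then have "card ((\<lambda>k. k * B + r) ` {..<D div B}) \<le> card {e. e < D \<and> e mod B = r}"
    by (intro card_mono) auto
  moreover have "inj_on (\<lambda>k. k * B + r) {..<D div B}" using assms by (auto intro: inj_onI)
  ultimately show ?thesis by (simp add: card_image)
qed

text \<open>Quotients by \<open>B\<close> are distinct within a residue class. The bound limits how
  many terms share a block in the second moment of the majorities.\<close>

lemma card_residue_class_le:
  fixes B D r :: nat
  assumes "r < B"
  shows "card {e. e < D \<and> e mod B = r} \<le> D div B + 1"
proof -
  have "inj_on (\<lambda>e. e div B) {e. e < D \<and> e mod B = r}"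
  proof (rule inj_onI)
    fix x y assume "x \<in> {e. e < D \<and> e mod B = r}" "y \<in> {e. e < D \<and> e mod B = r}" "x div B = y div B"
    then show "x = y" using div_mult_mod_eq[of x B] div_mult_mod_eq[of y B] by simp
  qed
  moreover have "(\<lambda>e. e div B) ` {e. e < D \<and> e mod B = r} \<subseteq> {..D div B}"
    by (auto intro: div_le_mono)
  ultimately have "card {e. e < D \<and> e mod B = r} \<le> card {..D div B}"
    by (metis card_inj_on_le finite_atMost)
  then show ?thesis by simp
qed

lemma div_eq_iff_interval:
  fixes i k w :: nat
  assumes "0 < w"
  shows "i div w = k \<longleftrightarrow> k * w \<le> i \<and> i < k * w + w"
proof
  assume "i div w = k"
  then have "k * w + i mod w = i" by auto
  moreover have "i mod w < w" using assms by simp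
  ultimately show "k * w \<le> i \<and> i < k * w + w" by linarith
next
  assume "k * w \<le> i \<and> i < k * w + w"
  then show "i div w = k" by (intro div_nat_eqI) (auto simp: mult.commute)
qed

text \<open>There are \<open>D\<close> terms of width \<open>w\<close> and \<open>B\<close> blocks
  of size \<open>m\<close>. Odd \<open>m\<close> excludes ties and makes a majority change sign when
  all its bits are negated. Variables beyond \<open>D * w + B * m\<close> are padding.\<close>

locale term_selected_majority =
  fixes w D m B n :: nat
  assumes w: "1 \<le> w" and m: "odd m" and B: "1 \<le> B" and n: "D * w + B * m \<le> n"
begin

definition X :: "nat set" where "X = {..<D * w}"

definition tvars :: "nat \<Rightarrow> nat set" where "tvars e = {e * w..<e * w + w}"

definition yvars :: "nat \<Rightarrow> nat set" where "yvars b = {D * w + b * m..<D * w + b * m + m}"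

definition sat :: "nat \<Rightarrow> (nat \<Rightarrow> bool) \<Rightarrow> bool" where "sat e z \<longleftrightarrow> (\<forall>i\<in>tvars e. z i)"

definition none :: "nat set \<Rightarrow> (nat \<Rightarrow> bool) \<Rightarrow> bool" where "none E z \<longleftrightarrow> (\<forall>e\<in>E. \<not> sat e z)"

definition only :: "nat \<Rightarrow> (nat \<Rightarrow> bool) \<Rightarrow> bool" where
  "only e z \<longleftrightarrow> sat e z \<and> none ({..<D} - {e}) z"

definition maj :: "nat \<Rightarrow> (nat \<Rightarrow> bool) \<Rightarrow> real" where
  "maj b z = (if m div 2 < card {i\<in>yvars b. z i} then 1 else -1)"

text \<open>The value is -1 if no term is satisfied, the majority of block \<open>e mod B\<close> if
  \<open>e\<close> is the only satisfied term, and 1 if at least two terms are satisfied.\<close>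

definition f :: "(nat \<Rightarrow> bool) \<Rightarrow> real" where
  "f z = 1 - 2 * of_bool (none {..<D} z) - (\<Sum>e<D. of_bool (only e z) * (1 - maj (e mod B) z))"

definition q :: real where "q = 1 / 2 ^ w"

lemma q_bounds: "0 < q" "q \<le> 1 / 2"
  using w power_increasing[of 1 w "2::real"] by (auto simp: q_def field_simps)

lemma tvars_subset: "e < D \<Longrightarrow> tvars e \<subseteq> X"
proof -
  assume "e < D"
  then have "Suc e * w \<le> D * w" by (intro mult_right_mono) auto
  then show ?thesis by (auto simp: tvars_def X_def)
qed

lemma tvars_div: "i \<in> tvars e \<longleftrightarrow> i div w = e"
  using w div_eq_iff_interval[of w i e] by (auto simp: tvars_def)

lemma yvars_iff: "i \<in> yvars b \<longleftrightarrow> D * w \<le> i \<and> (i - D * w) div m = b"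
proof -
  have "0 < m" using m by (simp add: odd_pos)
  then have "(i - D * w) div m = b \<longleftrightarrow> b * m \<le> i - D * w \<and> i - D * w < b * m + m"
    by (rule div_eq_iff_interval)
  moreover have "i \<in> yvars b \<longleftrightarrow> D * w \<le> i \<and> b * m \<le> i - D * w \<and> i - D * w < b * m + m"
    unfolding yvars_def atLeastLessThan_iff by linarith
  ultimately show ?thesis by simp
qed

lemma yvars_disjoint: "b \<noteq> b' \<Longrightarrow> yvars b \<inter> yvars b' = {}"
  by (auto simp: yvars_iff)

lemma yvars_X: "yvars b \<inter> X = {}"
  by (auto simp: yvars_iff X_def)

lemma yvars_subset: "b < B \<Longrightarrow> yvars b \<subseteq> {..<n}"
proof -
  assume "b < B"
  then have "Suc b * m \<le> B * m" by (intro mult_right_mono) auto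
  then show ?thesis using n by (auto simp: yvars_def)
qed

lemma X_subset: "X \<subseteq> {..<n}"
  using n by (auto simp: X_def)

lemma finite_yvars: "finite (yvars b)" and card_yvars: "card (yvars b) = m"
  and finite_tvars: "finite (tvars e)" and card_tvars: "card (tvars e) = w"
  by (auto simp: yvars_def tvars_def)

lemma depends_sat: "depends_on (tvars e) (sat e)"
  by (auto simp: depends_on_def sat_def)

lemma depends_none: "depends_on (\<Union>e\<in>E. tvars e) (none E)"
  by (auto simp: depends_on_def none_def sat_def)

lemma depends_none_X: "depends_on X (none {..<D})"
  by (rule depends_on_mono[OF depends_none]) (use tvars_subset in auto)

lemma depends_only: "e < D \<Longrightarrow> depends_on X (only e)"
proof -
  assume e: "e < D"
  have "depends_on X (sat e)" "depends_on X (none ({..<D} - {e}))"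
    by (rule depends_on_mono[OF depends_sat tvars_subset[OF e]],
        rule depends_on_mono[OF depends_none]) (use tvars_subset in auto)
  then show ?thesis unfolding depends_on_def only_def by blast
qed

lemma depends_maj: "depends_on (yvars b) (maj b)"
proof (unfold depends_on_def, intro allI impI)
  fix x y :: "nat \<Rightarrow> bool" assume "\<forall>i\<in>yvars b. x i = y i"
  then have "{i\<in>yvars b. x i} = {i\<in>yvars b. y i}" by auto
  then show "maj b x = maj b y" by (simp add: maj_def)
qed

lemma depends_of_bool: "depends_on V P \<Longrightarrow> depends_on V (\<lambda>x. of_bool (P x) :: real)"
  by (rule depends_on_comp)

lemma maj_sign: "maj b z \<in> {-1, 1}"
  by (simp add: maj_def)

lemma only_unique: "only e z \<Longrightarrow> only e' z \<Longrightarrow> e < D \<Longrightarrow> e' < D \<Longrightarrow> e = e'"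
  by (auto simp: only_def none_def)

lemma f_none: "none {..<D} z \<Longrightarrow> f z = -1"
  by (auto simp: f_def only_def none_def intro!: sum.neutral)

lemma f_only:
  assumes "e < D" "only e z"
  shows "f z = maj (e mod B) z"
proof -
  have "(\<Sum>e'<D. of_bool (only e' z) * (1 - maj (e' mod B) z)) =
      (\<Sum>e'<D. if e' = e then 1 - maj (e mod B) z else 0)"
    using assms only_unique by (intro sum.cong) auto
  moreover have "\<not> none {..<D} z" using assms by (auto simp: only_def none_def)
  ultimately show ?thesis using assms by (simp add: f_def)
qed

lemma f_many: "\<not> none {..<D} z \<Longrightarrow> (\<And>e. e < D \<Longrightarrow> \<not> only e z) \<Longrightarrow> f z = 1"
  by (simp add: f_def)

lemma sign_fun_f: "sign_fun f"
  unfolding sign_fun_def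
proof
  fix z
  consider "none {..<D} z" | e where "e < D" "only e z" | "\<not> none {..<D} z" "\<And>e. e < D \<Longrightarrow> \<not> only e z"
    by blast
  then show "f z \<in> {-1, 1}"
    by cases (use f_none f_only f_many maj_sign in auto)
qed

lemma mono_maj: "x \<le> y \<Longrightarrow> maj b x \<le> maj b y"
proof -
  assume "x \<le> y"
  then have "card {i\<in>yvars b. x i} \<le> card {i\<in>yvars b. y i}"
    using finite_yvars by (intro card_mono) (auto simp: le_fun_def)
  then show ?thesis by (simp add: maj_def)
qed

lemma sat_mono: "x \<le> y \<Longrightarrow> sat e x \<Longrightarrow> sat e y"
  by (auto simp: sat_def le_fun_def)

text \<open>Raising the input only adds satisfied terms. If the larger input has exactly one and the
  smaller has any, both have the same one, so the same block is consulted and its majority is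
  monotone.\<close>

lemma mono_f: "mono f"
proof (rule monoI)
  fix x y :: "nat \<Rightarrow> bool" assume le: "x \<le> y"
  have sgn: "f z = -1 \<or> f z = 1" for z using sign_fun_f by (auto simp: sign_fun_def)
  consider "none {..<D} x" | "\<not> none {..<D} x" "\<And>e. e < D \<Longrightarrow> \<not> only e y"
    | e where "e < D" "only e y" "\<not> none {..<D} x"
    by blast
  then show "f x \<le> f y"
  proof cases
    case 1
    then show ?thesis using f_none sgn[of y] by auto
  next
    case 2
    have "\<not> none {..<D} y" using 2(1) sat_mono[OF le] by (auto simp: none_def)
    then show ?thesis using f_many[of y] 2(2) sgn[of x] by auto
  next
    case 3
    have "only e x" using 3 sat_mono[OF le] by (auto simp: only_def none_def)
    then show ?thesis using 3 f_only[of e] mono_maj[OF le] by simp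
  qed
qed

section \<open>Distribution of terms and majorities, and correlation with \<open>f\<close>\<close>

lemma mean_sat: "e < D \<Longrightarrow> mean n (\<lambda>z. of_bool (sat e z)) = q"
  using mean_all_ones[of "tvars e"] tvars_subset[of e] X_subset by (auto simp: sat_def q_def card_tvars)

lemma mean_none:
  assumes "finite E" "E \<subseteq> {..<D}"
  shows "mean n (\<lambda>z. of_bool (none E z)) = (1 - q) ^ card E"
  using assms
proof (induction E rule: finite_induct)
  case empty
  then show ?case by (simp add: none_def mean_const)
next
  case (insert e E)
  have "mean n (\<lambda>z. of_bool (none (insert e E) z)) =
      mean n (\<lambda>z. (1 - of_bool (sat e z)) * of_bool (none E z))"
    by (intro mean_cong) (auto simp: none_def)
  also have "\<dots> = mean n (\<lambda>z. 1 - of_bool (sat e z)) * mean n (\<lambda>z. of_bool (none E z))"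
  proof (rule mean_mult_indep)
    show "depends_on (tvars e) (\<lambda>z. 1 - of_bool (sat e z) :: real)"
      by (rule depends_on_comp[OF depends_sat])
    show "depends_on (\<Union>e\<in>E. tvars e) (\<lambda>z. of_bool (none E z) :: real)"
      by (intro depends_of_bool depends_none)
    show "tvars e \<inter> (\<Union>e\<in>E. tvars e) = {}" using insert.hyps(2) by (auto simp: tvars_div)
  qed
  also have "\<dots> = (1 - q) * (1 - q) ^ card E"
    using insert by (simp add: mean_diff mean_const mean_sat)
  finally show ?case using insert.hyps by simp
qed

text \<open>The probability that one given term is the only satisfied one.\<close>

definition p1 :: real where "p1 = q * (1 - q) ^ (D - 1)"

lemma p1_bounds: "0 \<le> p1" "p1 \<le> q"
  using q_bounds by (auto simp: p1_def intro!: mult_left_le power_le_one)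

lemma mean_only:
  assumes "e < D"
  shows "mean n (\<lambda>z. of_bool (only e z)) = p1"
proof -
  have "mean n (\<lambda>z. of_bool (only e z)) =
      mean n (\<lambda>z. of_bool (sat e z) * of_bool (none ({..<D} - {e}) z))"
    by (intro mean_cong) (auto simp: only_def)
  also have "\<dots> = mean n (\<lambda>z. of_bool (sat e z)) * mean n (\<lambda>z. of_bool (none ({..<D} - {e}) z))"
    by (rule mean_mult_indep[OF depends_of_bool[OF depends_sat] depends_of_bool[OF depends_none]])
      (auto simp: tvars_div)
  also have "\<dots> = p1"
    using assms by (simp add: mean_sat mean_none p1_def)
  finally show ?thesis .
qed

lemma maj_complement: "maj b (\<lambda>i. \<not> z i) = - maj b z"
proof -
  have "yvars b = {i\<in>yvars b. \<not> z i} \<union> {i\<in>yvars b. z i}" by auto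
  then have "m = card ({i\<in>yvars b. \<not> z i} \<union> {i\<in>yvars b. z i})" using card_yvars[of b] by simp
  also have "\<dots> = card {i\<in>yvars b. \<not> z i} + card {i\<in>yvars b. z i}"
    using finite_yvars by (intro card_Un_disjoint) auto
  finally have "m = card {i\<in>yvars b. \<not> z i} + card {i\<in>yvars b. z i}" .
  then show ?thesis using m by (auto simp: maj_def elim!: oddE)
qed

lemma mean_maj: "b < B \<Longrightarrow> mean n (maj b) = 0"
  using mean_complement[OF depends_on_mono[OF depends_maj yvars_subset], of b]
    mean_cmult[of n "-1" "maj b"]
  by (simp add: maj_complement)

text \<open>Distinct blocks are independent and each majority has mean zero, so the majorities are
  orthonormal.\<close>

lemma mean_maj_mult:
  assumes "b < B" "b' < B"
  shows "mean n (\<lambda>z. maj b z * maj b' z) = of_bool (b = b')"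
proof (cases "b = b'")
  case True
  have "maj b z * maj b z = 1" for z by (simp add: maj_def)
  then show ?thesis using True by (simp add: mean_const)
next
  case False
  then show ?thesis
    using assms mean_maj mean_mult_indep[OF depends_maj depends_maj yvars_disjoint[OF False]] by simp
qed

text \<open>A \<open>\<plusminus>1\<close>-valued function of the variables outside the terms sees only the average of the
  majorities, whose second moment is small.\<close>

lemma mean_mult_f_le:
  assumes a: "depends_on (- X) a" and sgn: "\<And>z. a z \<in> {-1, 1}"
  shows "mean n (\<lambda>z. a z * f z) \<le>
    \<bar>1 - 2 * (1 - q) ^ D - D * p1\<bar> + q * sqrt (D * (D / B + 1))"
proof -
  define S where "S = (\<lambda>z. \<Sum>e<D. maj (e mod B) z)"
  have depm: "depends_on (- X) (\<lambda>z. a z * maj b z)" for b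
  proof -
    have "depends_on (- X) (maj b)"
      by (rule depends_on_mono[OF depends_maj]) (use yvars_X in auto)
    then have "maj b x = maj b y" "a x = a y" if "\<forall>i\<in>- X. x i = y i" for x y
      using a that unfolding depends_on_def by blast+
    then show ?thesis
      unfolding depends_on_def by (intro allI impI arg_cong2[where f = "(*)"]) blast+
  qed
  \<comment> \<open>Term events live on \<open>X\<close>, while \<open>a\<close> and the majorities
    live off it, so the means factor.\<close>
  have t0: "mean n (\<lambda>z. a z * of_bool (none {..<D} z)) = mean n a * (1 - q) ^ D"
    using mean_mult_indep[OF a depends_of_bool[OF depends_none_X]] by (simp add: mean_none)
  have t1: "mean n (\<lambda>z. a z * of_bool (only e z)) = mean n a * p1" if "e < D" for e
    using mean_mult_indep[OF a depends_of_bool[OF depends_only[OF that]]] that by (simp add: mean_only)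
  have t2: "mean n (\<lambda>z. a z * maj (e mod B) z * of_bool (only e z)) =
      mean n (\<lambda>z. a z * maj (e mod B) z) * p1" if "e < D" for e
    using mean_mult_indep[OF depm depends_of_bool[OF depends_only[OF that]]] that by (simp add: mean_only)
  define d1 d2 where "d1 = (\<lambda>e z. a z * of_bool (only e z))"
    and "d2 = (\<lambda>e z. a z * maj (e mod B) z * of_bool (only e z))"
  have "a z * f z = a z - 2 * (a z * of_bool (none {..<D} z)) - (\<Sum>e<D. d1 e z - d2 e z)" for z
  proof -
    have "(\<Sum>e<D. d1 e z - d2 e z) = a z * (\<Sum>e<D. of_bool (only e z) * (1 - maj (e mod B) z))"
      unfolding sum_distrib_left d1_def d2_def by (intro sum.cong refl) (simp add: right_diff_distrib)
    then show ?thesis by (simp add: f_def right_diff_distrib)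
  qed
  then have "mean n (\<lambda>z. a z * f z) =
      mean n a - 2 * mean n (\<lambda>z. a z * of_bool (none {..<D} z)) - (\<Sum>e<D. mean n (d1 e) - mean n (d2 e))"
    by (simp add: mean_diff mean_cmult mean_sum)
  also have "(\<Sum>e<D. mean n (d1 e) - mean n (d2 e)) =
      (\<Sum>e<D. mean n a * p1 - mean n (\<lambda>z. a z * maj (e mod B) z) * p1)"
    unfolding d1_def d2_def by (intro sum.cong refl arg_cong2[where f = "(-)"] t1 t2) auto
  also have "\<dots> = D * (mean n a * p1) - p1 * (\<Sum>e<D. mean n (\<lambda>z. a z * maj (e mod B) z))"
    unfolding sum_subtractf sum_distrib_right[symmetric] by simp
  \<comment> \<open>The coefficient of \<open>mean n a\<close> is the mean of \<open>f\<close>,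
    since the majorities average to zero.\<close>
  also have "mean n a - 2 * mean n (\<lambda>z. a z * of_bool (none {..<D} z)) - \<dots> =
      mean n a * (1 - 2 * (1 - q) ^ D - D * p1) +
      p1 * (\<Sum>e<D. mean n (\<lambda>z. a z * maj (e mod B) z))"
    unfolding t0 by (simp add: algebra_simps)
  also have "(\<Sum>e<D. mean n (\<lambda>z. a z * maj (e mod B) z)) = mean n (\<lambda>z. a z * S z)"
    unfolding S_def by (simp add: sum_distrib_left mean_sum)
  also have "mean n a * (1 - 2 * (1 - q) ^ D - D * p1) \<le> \<bar>1 - 2 * (1 - q) ^ D - D * p1\<bar>"
  proof -
    have "-1 \<le> a z" "a z \<le> 1" for z using sgn[of z] by auto
    then have "mean n (\<lambda>_. -1) \<le> mean n a" "mean n a \<le> mean n (\<lambda>_. 1)"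
      by (auto intro: mean_mono)
    then have "\<bar>mean n a\<bar> \<le> 1" by (simp add: mean_const)
    then have "\<bar>mean n a * (1 - 2 * (1 - q) ^ D - D * p1)\<bar> \<le> \<bar>1 - 2 * (1 - q) ^ D - D * p1\<bar>"
      unfolding abs_mult by (intro mult_left_le_one_le) auto
    then show ?thesis by linarith
  qed
  also have "p1 * mean n (\<lambda>z. a z * S z) \<le> q * sqrt (D * (D / B + 1))"
  proof -
    have "(mean n (\<lambda>z. a z * S z))\<^sup>2 \<le> mean n (\<lambda>z. (a z * S z)\<^sup>2)" by (rule mean_square_le)
    also have "\<dots> = mean n (\<lambda>z. (S z)\<^sup>2)"
    proof (rule mean_cong)
      fix z
      have "(a z)\<^sup>2 = 1" using sgn[of z] by auto
      then show "(a z * S z)\<^sup>2 = (S z)\<^sup>2" by (simp add: power_mult_distrib)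
    qed
    also have "\<dots> = (\<Sum>e<D. \<Sum>e'<D. mean n (\<lambda>z. maj (e mod B) z * maj (e' mod B) z))"
      unfolding S_def power2_eq_square sum_product mean_sum ..
    \<comment> \<open>By orthonormality only pairs of terms selecting the same block
      survive.\<close>
    also have "\<dots> = (\<Sum>e<D. \<Sum>e'<D. of_bool (e' mod B = e mod B))"
      using B by (intro sum.cong refl) (subst mean_maj_mult, auto)
    also have "\<dots> = (\<Sum>e<D. real (card {e'. e' < D \<and> e' mod B = e mod B}))"
      by (simp add: sum.If_cases of_bool_def Int_def)
    also have "\<dots> \<le> (\<Sum>e<D. D / B + 1)"
    proof (rule sum_mono)
      fix e
      have "real (card {e'. e' < D \<and> e' mod B = e mod B}) \<le> real (D div B + 1)"
        using B by (intro of_nat_mono card_residue_class_le) simp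
      also have "\<dots> \<le> D / B + 1" using of_nat_div_le_of_nat[of D B] by simp
      finally show "real (card {e'. e' < D \<and> e' mod B = e mod B}) \<le> D / B + 1" .
    qed
    finally have "\<bar>mean n (\<lambda>z. a z * S z)\<bar> \<le> sqrt (D * (D / B + 1))"
      by (intro real_le_rsqrt) simp
    then have "p1 * \<bar>mean n (\<lambda>z. a z * S z)\<bar> \<le> q * sqrt (D * (D / B + 1))"
      using p1_bounds q_bounds by (intro mult_mono) auto
    moreover have "p1 * mean n (\<lambda>z. a z * S z) \<le> p1 * \<bar>mean n (\<lambda>z. a z * S z)\<bar>"
      using p1_bounds by (intro mult_left_mono) auto
    ultimately show ?thesis by linarith
  qed
  finally show ?thesis by simp
qed

end

section \<open>A small decision tree for \<open>f\<close>\<close>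

fun query_all :: "nat list \<Rightarrow> ((nat \<Rightarrow> bool) \<Rightarrow> 'a dtree) \<Rightarrow> (nat \<Rightarrow> bool) \<Rightarrow> 'a dtree" where
  "query_all [] k z = k z"
| "query_all (i # is) k z = Query i (query_all is k (z(i := False))) (query_all is k (z(i := True)))"

text \<open>The continuation \<open>k\<close> receives the answers collected so far, which lets
  later queries depend on them; positions never read keep their value in \<open>z\<close>.\<close>

lemma run_query_all:
  "run_tree (query_all is k z) x = run_tree (k (\<lambda>i. if i \<in> set is then x i else z i)) x"
proof (induction "is" arbitrary: z)
  case (Cons j js)
  have "(\<lambda>i. if i \<in> set js then x i else (z(j := x j)) i) = (\<lambda>i. if i \<in> set (j # js) then x i else z i)"
    by auto
  then show ?case using Cons.IH[of "z(j := x j)"] by (cases "x j") (simp_all del: fun_upd_apply)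
qed simp

lemma size_query_all:
  "(\<And>z. tree_size (k z) \<le> M) \<Longrightarrow> tree_size (query_all is k z) \<le> 2 ^ length is * M"
proof (induction "is" arbitrary: z)
  case (Cons j js)
  have "tree_size (query_all js k z) \<le> 2 ^ length js * M" for z by (rule Cons.IH[OF Cons.prems])
  from add_mono[OF this[of "z(j := False)"] this[of "z(j := True)"]] show ?case
    by (simp add: algebra_simps del: fun_upd_apply)
qed simp

lemma tree_over_query_all:
  "distinct is \<Longrightarrow> set is \<subseteq> V \<Longrightarrow> (\<And>z. tree_over (V - set is) (k z)) \<Longrightarrow> tree_over V (query_all is k z)"
proof (induction "is" arbitrary: z V)
  case (Cons j js)
  have "V - set (j # js) = V - {j} - set js" by auto
  then have "tree_over (V - {j} - set js) (k z)" for z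
    using Cons.prems(3)[of z] by (simp only:)
  moreover have "distinct js" "set js \<subseteq> V - {j}" "j \<in> V" using Cons.prems(1,2) by auto
  ultimately have "tree_over (V - {j}) (query_all js k z)" for z by (intro Cons.IH)
  then show ?case using \<open>j \<in> V\<close> by simp
qed simp

context term_selected_majority
begin

text \<open>\<open>f\<close> sees an input only through the truth values of the terms and the
  majority of the selected block. This serves both the correctness of the tree and the bound on the
  influence of term variables.\<close>

lemma f_cong:
  assumes "\<And>e. e < D \<Longrightarrow> sat e x = sat e y" "\<And>e. e < D \<Longrightarrow> only e x \<Longrightarrow> maj (e mod B) x = maj (e mod B) y"
  shows "f x = f y"
proof -
  have "none {..<D} x = none {..<D} y" "\<And>e. e < D \<Longrightarrow> only e x = only e y"
    using assms(1) by (auto simp: only_def none_def)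
  then show ?thesis using assms(2) unfolding f_def by (auto intro!: sum.cong)
qed

text \<open>The choice operator picks a uniquely determined term, by \<open>only_unique\<close>. A
  list, rather than a set, is what \<open>query_all\<close> consumes.\<close>

definition block_vars :: "(nat \<Rightarrow> bool) \<Rightarrow> nat list" where
  "block_vars z = (if \<exists>e<D. only e z
     then [D * w + ((SOME e. e < D \<and> only e z) mod B) * m..<D * w + ((SOME e. e < D \<and> only e z) mod B) * m + m]
     else [])"

lemma block_vars_only: "e < D \<Longrightarrow> only e z \<Longrightarrow> set (block_vars z) = yvars (e mod B)"
proof -
  assume e: "e < D" "only e z"
  then have "(SOME e. e < D \<and> only e z) = e" using only_unique by blast
  then show ?thesis using e by (auto simp: block_vars_def yvars_def)
qed

text \<open>Below the terms only the selected block is read, so the exponent contains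
  \<open>m\<close> and not \<open>B * m\<close>.\<close>

lemma computable_f: "computable_with_size n f (2 ^ (D * w + m))"
proof -
  define k where "k = (\<lambda>z. query_all (block_vars z) (\<lambda>z'. Leaf (f z')) z)"
  define T where "T = query_all [0..<D * w] k (\<lambda>_. False)"
  have set_block: "set (block_vars z) \<subseteq> {..<n} - X" for z
  proof (cases "\<exists>e<D. only e z")
    case True
    then obtain e where e: "e < D" "only e z" by blast
    have "e mod B < B" using B by simp
    then show ?thesis
      unfolding block_vars_only[OF e] using yvars_subset yvars_X by blast
  next
    case False
    then show ?thesis unfolding block_vars_def if_not_P[OF False] by simp
  qed
  have "tree_over {..<n} T"
    unfolding T_def
  proof (intro tree_over_query_all)
    show "set [0..<D * w] \<subseteq> {..<n}" using X_subset by (auto simp: X_def)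
    fix z
    have "{..<n} - set [0..<D * w] = {..<n} - X" by (auto simp: X_def)
    then show "tree_over ({..<n} - set [0..<D * w]) (k z)"
      unfolding k_def using set_block by (intro tree_over_query_all) (auto simp: block_vars_def)
  qed simp
  moreover have "tree_size T \<le> 2 ^ (D * w + m)"
  proof -
    have "tree_size (k z) \<le> 2 ^ m" for z
    proof -
      have "tree_size (k z) \<le> 2 ^ length (block_vars z) * 1"
        unfolding k_def by (intro size_query_all) simp
      also have "\<dots> \<le> 2 ^ m"
        unfolding mult_1_right by (intro power_increasing) (auto simp: block_vars_def)
      finally show ?thesis .
    qed
    then have "tree_size T \<le> 2 ^ length [0..<D * w] * 2 ^ m"
      unfolding T_def by (intro size_query_all)
    then show ?thesis by (simp add: power_add)
  qed
  moreover have "run_tree T x = f x" for x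
  proof -
    \<comment> \<open>\<open>z\<close> is what is known after the terms and \<open>z'\<close> what
      is known after the block; the default False at unread positions is harmless by
      \<open>f_cong\<close>.\<close>
    define z where "z = (\<lambda>i. if i \<in> set [0..<D * w] then x i else False)"
    define z' where "z' = (\<lambda>i. if i \<in> set (block_vars z) then x i else z i)"
    have "run_tree T x = f z'"
      unfolding T_def run_query_all k_def z'_def z_def by simp
    also have "\<dots> = f x"
    proof (rule f_cong)
      fix e assume e: "e < D"
      have satz: "sat e' z = sat e' x" if "e' < D" for e'
        using tvars_subset[OF that] by (intro depends_onD[OF depends_sat]) (auto simp: z_def X_def)
      have satz': "sat e' z' = sat e' x" if "e' < D" for e'
        using tvars_subset[OF that]
        by (intro depends_onD[OF depends_sat]) (auto simp: z'_def z_def X_def)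
      show "sat e z' = sat e x" by (rule satz'[OF e])
      show "maj (e mod B) z' = maj (e mod B) x" if "only e z'"
      proof -
        have "only e z" using that satz satz' e by (auto simp: only_def none_def)
        then have "set (block_vars z) = yvars (e mod B)" by (rule block_vars_only[OF e])
        then show ?thesis by (intro depends_onD[OF depends_maj]) (auto simp: z'_def)
      qed
    qed
    finally show ?thesis .
  qed
  ultimately show ?thesis unfolding computable_with_size_def by blast
qed

section \<open>Trees cut off at their first term variable\<close>

fun hit :: "'a dtree \<Rightarrow> (nat \<Rightarrow> bool) \<Rightarrow> bool" where
  "hit (Leaf a) z = False"
| "hit (Query i l r) z = (i \<in> X \<or> (if z i then hit r z else hit l z))"

text \<open>The value 1 at a term variable is an arbitrary sign: it keeps completions sign-valued
  while removing every dependence on \<open>X\<close>.\<close>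

fun run_off :: "real dtree \<Rightarrow> (nat \<Rightarrow> bool) \<Rightarrow> real" where
  "run_off (Leaf a) z = a"
| "run_off (Query i l r) z = (if i \<in> X then 1 else if z i then run_off r z else run_off l z)"

lemma hit_completion: "hit (completion n' g T) = hit T"
  by (induction T arbitrary: g) (auto simp: fun_eq_iff)

lemma run_off_completion: "run_off (completion n' g T) z \<in> {-1, 1}"
  by (induction T arbitrary: g) auto

lemma run_off_eq: "\<not> hit T z \<Longrightarrow> run_off T z = run_tree T z"
  by (induction T) (auto split: if_splits)

lemma depends_run_off: "depends_on (- X) (run_off T)"
proof -
  have "run_off T x = run_off T y" if "\<forall>i\<in>- X. x i = y i" for x y
    using that by (induction T) auto
  then show ?thesis unfolding depends_on_def by blast
qed

text \<open>Where no term variable is met, the completion agrees with \<open>run_off\<close>, which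
  is almost uncorrelated with \<open>f\<close> and so errs on nearly half of the cube. A smaller
  error must be paid for by \<open>hit\<close>.\<close>

lemma hit_prob_ge:
  "1 / 2 - tree_error n f (completion n f T)
     - (\<bar>1 - 2 * (1 - q) ^ D - D * p1\<bar> + q * sqrt (D * (D / B + 1))) / 2
   \<le> mean n (\<lambda>z. of_bool (hit T z))"
proof -
  define C where "C = completion n f T"
  define a where "a = run_off C"
  have sgn: "f z = -1 \<or> f z = 1" for z using sign_fun_f by (auto simp: sign_fun_def)
  have a: "a z \<in> {-1, 1}" for z unfolding a_def C_def by (rule run_off_completion)
  \<comment> \<open>For two signs, \<open>1 / 2 - 1 / 2 * (a z * f z)\<close> is the indicator of
    disagreement.\<close>
  have "mean n (\<lambda>z. 1 / 2 - 1 / 2 * (a z * f z)) \<le>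
      mean n (\<lambda>z. of_bool (run_tree C z \<noteq> f z) + of_bool (hit T z))"
  proof (rule mean_mono)
    fix z
    have "run_tree C z = a z" if "\<not> hit T z"
      using that by (simp add: a_def C_def run_off_eq hit_completion)
    then show "1 / 2 - 1 / 2 * (a z * f z) \<le> of_bool (run_tree C z \<noteq> f z) + of_bool (hit T z)"
      using a[of z] sgn[of z] by auto
  qed
  then have "1 / 2 - mean n (\<lambda>z. a z * f z) / 2 \<le>
      tree_error n f C + mean n (\<lambda>z. of_bool (hit T z))"
    unfolding tree_error_def prob_unif mean_add mean_diff mean_cmult mean_const by simp
  moreover have "mean n (\<lambda>z. a z * f z) \<le>
      \<bar>1 - 2 * (1 - q) ^ D - D * p1\<bar> + q * sqrt (D * (D / B + 1))"
    using a unfolding a_def by (intro mean_mult_f_le depends_run_off) auto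
  ultimately show ?thesis unfolding C_def by argo
qed

end

text \<open>\<open>map_of\<close> lets the earlier entry of a path win, in agreement with the order
  in which \<open>restrict_path\<close> applies its updates.\<close>

definition assign :: "path \<Rightarrow> (nat \<Rightarrow> bool) \<Rightarrow> nat \<Rightarrow> bool" where
  "assign \<rho> z = (\<lambda>i. case map_of \<rho> i of None \<Rightarrow> z i | Some v \<Rightarrow> v)"

lemma restrict_path_assign: "restrict_path g \<rho> z = g (assign \<rho> z)"
proof (induction g \<rho> rule: restrict_path.induct)
  case (2 g i b \<pi>)
  have "(assign \<pi> z)(i := b) = assign ((i, b) # \<pi>) z"
    by (auto simp: assign_def)
  then show ?case using 2 by (simp del: fun_upd_apply)
qed (simp add: assign_def)

context term_selected_majority
begin

section \<open>Imbalance of the blocks along a path\<close>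

definition ones :: "nat \<Rightarrow> path \<Rightarrow> nat" where
  "ones b \<rho> = card {i\<in>yvars b. map_of \<rho> i = Some True}"

definition zeros :: "nat \<Rightarrow> path \<Rightarrow> nat" where
  "zeros b \<rho> = card {i\<in>yvars b. map_of \<rho> i = Some False}"

text \<open>On a uniformly random path the answers within each block perform a simple random walk;
  this sums the squared positions.\<close>

definition \<Phi> :: "path \<Rightarrow> real" where
  "\<Phi> \<rho> = (\<Sum>b<B. (real (ones b \<rho>) - real (zeros b \<rho>))\<^sup>2)"

lemma \<Phi>_nonneg: "0 \<le> \<Phi> \<rho>"
  unfolding \<Phi>_def by (intro sum_nonneg) auto

lemma ones_snoc:
  assumes "i \<notin> fst ` set \<rho>"
  shows "ones b (\<rho> @ [(i, v)]) = ones b \<rho> + of_bool (v \<and> i \<in> yvars b)"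
    and "zeros b (\<rho> @ [(i, v)]) = zeros b \<rho> + of_bool (\<not> v \<and> i \<in> yvars b)"
proof -
  have i: "map_of \<rho> i = None" using assms by (simp add: map_of_eq_None_iff)
  have eq: "{j\<in>yvars b. map_of (\<rho> @ [(i, v)]) j = Some c} =
      (if v = c \<and> i \<in> yvars b then insert i {j\<in>yvars b. map_of \<rho> j = Some c}
       else {j\<in>yvars b. map_of \<rho> j = Some c})" for c
    using i by (auto simp: map_add_Some_iff split: if_splits)
  show "ones b (\<rho> @ [(i, v)]) = ones b \<rho> + of_bool (v \<and> i \<in> yvars b)"
    "zeros b (\<rho> @ [(i, v)]) = zeros b \<rho> + of_bool (\<not> v \<and> i \<in> yvars b)"
    unfolding ones_def zeros_def eq using i finite_yvars by auto
qed

text \<open>Along a uniformly random path, \<open>\<Phi>\<close> minus the number of queries is a supermartingale.\<close>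

lemma \<Phi>_snoc:
  assumes "i \<notin> fst ` set \<rho>"
  shows "\<Phi> (\<rho> @ [(i, False)]) + \<Phi> (\<rho> @ [(i, True)]) \<le> 2 * \<Phi> \<rho> + 2"
proof -
  \<comment> \<open>The identity behind this is
    \<open>(s - 1)\<^sup>2 + (s + 1)\<^sup>2 = 2 * s\<^sup>2 + 2\<close> for the block containing
    \<open>i\<close>; disjointness allows at most one such block.\<close>
  have "\<Phi> (\<rho> @ [(i, False)]) + \<Phi> (\<rho> @ [(i, True)]) =
      (\<Sum>b<B. 2 * (real (ones b \<rho>) - real (zeros b \<rho>))\<^sup>2 + 2 * of_bool (i \<in> yvars b))"
    unfolding \<Phi>_def sum.distrib[symmetric] ones_snoc[OF assms]
    by (intro sum.cong refl) (auto simp: power2_eq_square algebra_simps)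
  also have "\<dots> = 2 * \<Phi> \<rho> + 2 * (\<Sum>b<B. of_bool (i \<in> yvars b))"
    by (simp add: \<Phi>_def sum.distrib sum_distrib_left)
  also have "(\<Sum>b<B. of_bool (i \<in> yvars b) :: real) \<le> 1"
  proof (cases "\<exists>b<B. i \<in> yvars b")
    case True
    then obtain b where b: "b < B" "i \<in> yvars b" by blast
    have "(\<Sum>b'<B. of_bool (i \<in> yvars b') :: real) = (\<Sum>b'<B. of_bool (b' = b))"
      using b by (intro sum.cong refl) (auto simp: yvars_iff)
    then show ?thesis using b by (simp add: of_bool_def)
  qed (auto intro!: sum_nonpos)
  finally show ?thesis by simp
qed

lemma ones_plus_zeros: "ones b \<rho> + zeros b \<rho> = card (yvars b \<inter> fst ` set \<rho>)"
proof -
  have "yvars b \<inter> fst ` set \<rho> =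
      {i\<in>yvars b. map_of \<rho> i = Some True} \<union> {i\<in>yvars b. map_of \<rho> i = Some False}"
    unfolding dom_map_of_conv_image_fst[symmetric] dom_def by auto
  then show ?thesis
    unfolding ones_def zeros_def using finite_yvars by (subst card_Un_disjoint[symmetric]) auto
qed

lemma sum_queries_le: "(\<Sum>b<B. ones b \<rho> + zeros b \<rho>) \<le> length \<rho>"
proof -
  have "(\<Sum>b<B. card (yvars b \<inter> fst ` set \<rho>)) = card (\<Union>b\<in>{..<B}. yvars b \<inter> fst ` set \<rho>)"
    using yvars_disjoint by (intro card_UN_disjoint[symmetric]) auto
  also have "\<dots> \<le> card (fst ` set \<rho>)" by (intro card_mono) auto
  also have "\<dots> \<le> length \<rho>" using card_image_le[of "set \<rho>" fst] card_length[of \<rho>] by simp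
  finally show ?thesis unfolding ones_plus_zeros .
qed

section \<open>Influences after a path without term variables\<close>

lemma assign_X:
  assumes "fst ` set \<rho> \<inter> X = {}" "depends_on X P"
  shows "P (assign \<rho> z) = P z"
proof (rule depends_onD[OF assms(2)])
  fix i assume "i \<in> X"
  then have "map_of \<rho> i = None" using assms(1) by (auto simp: map_of_eq_None_iff)
  then show "assign \<rho> z i = z i" by (simp add: assign_def)
qed

text \<open>A change at \<open>i\<close> matters only if the other \<open>w - 1\<close> variables of
  its term are all 1. They are still uniform, so this has probability \<open>2 * q\<close>, and the
  value then changes by at most 2.\<close>

lemma infl_X_le:
  assumes \<rho>: "fst ` set \<rho> \<inter> X = {}" and i: "i \<in> X"
  shows "infl n (restrict_path f \<rho>) i \<le> 4 * q"
proof -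
  define e where "e = i div w"
  have e: "e < D" using i w by (simp add: e_def X_def less_mult_imp_div_less)
  have ie: "i \<in> tvars e" by (simp add: tvars_div e_def)
  define R where "R = tvars e - {i}"
  have none: "map_of \<rho> j = None" if "j \<in> X" for j
    using \<rho> that by (auto simp: map_of_eq_None_iff)
  have upd: "assign \<rho> (z(i := v)) = (assign \<rho> z)(i := v)" for z v
    using none[OF i] by (intro ext) (auto simp: assign_def split: option.split)
  have "f ((assign \<rho> z)(i := True)) - f ((assign \<rho> z)(i := False)) \<le> 2 * of_bool (\<forall>j\<in>R. z j)" for z
  proof (cases "\<forall>j\<in>R. z j")
    case True
    have "f y = -1 \<or> f y = 1" for y using sign_fun_f by (auto simp: sign_fun_def)
    from this[of "(assign \<rho> z)(i := True)"] this[of "(assign \<rho> z)(i := False)"]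
    show ?thesis using True by auto
  next
    case False
    then obtain j where j: "j \<in> tvars e" "j \<noteq> i" "\<not> z j" by (auto simp: R_def)
    have jz: "\<not> assign \<rho> z j" using j none[of j] tvars_subset[OF e] by (auto simp: assign_def)
    have "f ((assign \<rho> z)(i := True)) = f ((assign \<rho> z)(i := False))"
    proof (rule f_cong)
      fix e' assume "e' < D"
      show "sat e' ((assign \<rho> z)(i := True)) = sat e' ((assign \<rho> z)(i := False))"
      proof (cases "e' = e")
        case True
        then show ?thesis using j jz by (auto simp: sat_def)
      next
        case False
        then have "i \<notin> tvars e'" using ie by (simp add: tvars_div)
        then show ?thesis by (simp add: depends_on_fun_upd[OF depends_sat])
      qed
      have "i \<notin> yvars (e' mod B)" using i yvars_X by auto
      then show "maj (e' mod B) ((assign \<rho> z)(i := True)) = maj (e' mod B) ((assign \<rho> z)(i := False))"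
        by (simp add: depends_on_fun_upd[OF depends_maj])
    qed
    then show ?thesis by simp
  qed
  then have "infl n (restrict_path f \<rho>) i \<le> mean n (\<lambda>z. 2 * of_bool (\<forall>j\<in>R. z j))"
    unfolding infl_def restrict_path_assign mean_diff[symmetric] upd by (intro mean_mono) auto
  also have "\<dots> = 2 * (1 / 2 ^ card R)"
    using tvars_subset[OF e] X_subset unfolding mean_cmult R_def by (subst mean_all_ones) auto
  also have "card R = w - 1" using ie finite_tvars by (simp add: R_def card_tvars)
  also have "2 * (1 / 2 ^ (w - 1)) = 4 * q"
    using w power_Suc[of "2::real" "w - 1"] by (simp add: q_def field_simps)
  finally show ?thesis .
qed

text \<open>The variable \<open>j\<close> matters exactly when a single term is satisfied, it
  selects block \<open>b\<close>, and the \<open>M\<close> other unread variables of the block make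
  \<open>j\<close> pivotal; the value then jumps by 2. The bound on \<open>ones b \<rho>\<close>
  keeps the subtraction in the binomial coefficient genuine.\<close>

lemma infl_yvars_eq:
  assumes \<rho>: "fst ` set \<rho> \<inter> X = {}" and b: "b < B" and j: "j \<in> yvars b" "j \<notin> fst ` set \<rho>"
    and u: "ones b \<rho> \<le> m div 2"
  defines "M \<equiv> m - 1 - (ones b \<rho> + zeros b \<rho>)"
  shows "infl n (restrict_path f \<rho>) j =
    card {e. e < D \<and> e mod B = b} * p1 * (2 * ((M choose (m div 2 - ones b \<rho>)) / 2 ^ M))"
proof -
  define R where "R = yvars b - fst ` set \<rho> - {j}"
  define U where "U = (\<lambda>c. {i\<in>yvars b. map_of \<rho> i = Some c})"
  have Uc: "card (U True) = ones b \<rho>" "card (U False) = zeros b \<rho>"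
    by (auto simp: U_def ones_def zeros_def)
  have finU: "finite (U c)" for c using finite_yvars by (simp add: U_def)
  have finR: "finite R" using finite_yvars by (simp add: R_def)
  have dom: "i \<in> fst ` set \<rho> \<longleftrightarrow> map_of \<rho> i \<noteq> None" for i
    by (simp add: map_of_eq_None_iff)
  have jnone: "map_of \<rho> j = None" using j dom by blast
  have part: "yvars b = insert j (R \<union> (U True \<union> U False))"
  proof (rule set_eqI)
    fix i
    have "map_of \<rho> i = None \<or> map_of \<rho> i = Some True \<or> map_of \<rho> i = Some False"
      by (cases "map_of \<rho> i") auto
    then show "i \<in> yvars b \<longleftrightarrow> i \<in> insert j (R \<union> (U True \<union> U False))"
      using j(1) unfolding R_def U_def by (auto simp: dom simp del: not_None_eq)
  qed
  have "m = card (insert j (R \<union> (U True \<union> U False)))" using part card_yvars[of b] by simp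
  also have "\<dots> = Suc (card R + (ones b \<rho> + zeros b \<rho>))"
  proof -
    have "card (R \<union> (U True \<union> U False)) = card R + (card (U True) + card (U False))"
      using finR finU by (subst card_Un_disjoint; (subst card_Un_disjoint)?) (auto simp: R_def U_def dom)
    moreover have "j \<notin> R \<union> (U True \<union> U False)" using jnone by (auto simp: R_def U_def)
    ultimately show ?thesis using finR finU Uc by simp
  qed
  finally have cR: "card R = M" by (simp add: M_def)
  have cnt: "card {i\<in>yvars b. assign \<rho> (z(j := v)) i} = of_bool v + (card {i\<in>R. z i} + ones b \<rho>)" for z v
  proof -
    have "{i\<in>yvars b. assign \<rho> (z(j := v)) i} =
        (if v then {j} else {}) \<union> ({i\<in>R. z i} \<union> U True)"
    proof (rule set_eqI)
      fix i
      have "map_of \<rho> i = None \<or> map_of \<rho> i = Some True \<or> map_of \<rho> i = Some False"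
        by (cases "map_of \<rho> i") auto
      then show "i \<in> {i\<in>yvars b. assign \<rho> (z(j := v)) i} \<longleftrightarrow>
          i \<in> (if v then {j} else {}) \<union> ({i\<in>R. z i} \<union> U True)"
        using j(1) jnone unfolding R_def U_def assign_def by (auto simp: dom simp del: not_None_eq split: if_splits)
    qed
    moreover have "card \<dots> = of_bool v + (card {i\<in>R. z i} + card (U True))"
      using finR finU jnone
      by (subst card_Un_disjoint; (subst card_Un_disjoint)?) (auto simp: R_def U_def dom)
    ultimately show ?thesis using Uc by simp
  qed
  have diff: "f (assign \<rho> (z(j := True))) - f (assign \<rho> (z(j := False))) =
      (\<Sum>e | e < D \<and> e mod B = b. of_bool (only e z) * (2 * of_bool (card {i\<in>R. z i} = m div 2 - ones b \<rho>)))" for z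
  proof -
    have jX: "j \<notin> X" using j yvars_X by blast
    have only: "only e (assign \<rho> (z(j := v))) = only e z" if "e < D" for e v
      using depends_only[OF that] assign_X[OF \<rho> depends_only[OF that]] jX
      by (simp add: depends_on_fun_upd del: fun_upd_apply)
    have none: "none {..<D} (assign \<rho> (z(j := v))) = none {..<D} z" for v
      using assign_X[OF \<rho> depends_none_X] jX
      by (simp add: depends_on_fun_upd[OF depends_none_X] del: fun_upd_apply)
    have majb: "maj b (assign \<rho> (z(j := True))) - maj b (assign \<rho> (z(j := False))) =
        2 * of_bool (card {i\<in>R. z i} = m div 2 - ones b \<rho>)"
      unfolding maj_def cnt using u by auto
    have majb': "maj b' (assign \<rho> (z(j := True))) = maj b' (assign \<rho> (z(j := False)))" if "b' \<noteq> b" for b'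
    proof (rule depends_onD[OF depends_maj])
      fix i assume "i \<in> yvars b'"
      then have "i \<noteq> j" using j that by (auto simp: yvars_iff)
      then show "assign \<rho> (z(j := True)) i = assign \<rho> (z(j := False)) i"
        by (simp add: assign_def split: option.split)
    qed
    have "f (assign \<rho> (z(j := True))) - f (assign \<rho> (z(j := False))) =
      (\<Sum>e<D. of_bool (only e z) * (maj (e mod B) (assign \<rho> (z(j := True))) - maj (e mod B) (assign \<rho> (z(j := False)))))"
    proof -
      have "f (assign \<rho> (z(j := v))) = 1 - 2 * of_bool (none {..<D} z) -
        (\<Sum>e<D. of_bool (only e z) * (1 - maj (e mod B) (assign \<rho> (z(j := v)))))" for v
        unfolding f_def none using only by (auto intro!: sum.cong)
      then show ?thesis
        by (simp add: sum_subtractf[symmetric] right_diff_distrib del: fun_upd_apply)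
    qed
    also have "\<dots> = (\<Sum>e | e < D \<and> e mod B = b. of_bool (only e z) *
        (maj (e mod B) (assign \<rho> (z(j := True))) - maj (e mod B) (assign \<rho> (z(j := False)))))"
      using majb' by (intro sum.mono_neutral_right) (auto simp del: fun_upd_apply)
    finally show ?thesis using majb by (auto intro!: sum.cong simp del: fun_upd_apply)
  qed
  \<comment> \<open>Selection of the block lives on \<open>X\<close> and the pivotal count on
    \<open>R\<close>, so their probabilities multiply.\<close>
  have RX: "X \<inter> R = {}" using yvars_X by (auto simp: R_def)
  have depR: "depends_on R (\<lambda>z. 2 * of_bool (card {i\<in>R. z i} = m div 2 - ones b \<rho>) :: real)"
  proof (unfold depends_on_def, intro allI impI)
    fix x y :: "nat \<Rightarrow> bool" assume "\<forall>i\<in>R. x i = y i"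
    then have "{i\<in>R. x i} = {i\<in>R. y i}" by auto
    then show "2 * of_bool (card {i\<in>R. x i} = m div 2 - ones b \<rho>) =
      (2 * of_bool (card {i\<in>R. y i} = m div 2 - ones b \<rho>) :: real)" by simp
  qed
  have "infl n (restrict_path f \<rho>) j =
      (\<Sum>e | e < D \<and> e mod B = b. mean n (\<lambda>z. of_bool (only e z) *
        (2 * of_bool (card {i\<in>R. z i} = m div 2 - ones b \<rho>))))"
    unfolding infl_def restrict_path_assign mean_diff[symmetric] diff mean_sum ..
  also have "\<dots> = (\<Sum>e | e < D \<and> e mod B = b. p1 * (2 * ((M choose (m div 2 - ones b \<rho>)) / 2 ^ M)))"
  proof (rule sum.cong[OF refl])
    fix e assume "e \<in> {e. e < D \<and> e mod B = b}"
    then have e: "e < D" by simp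
    have Rn: "R \<subseteq> {..<n}" using yvars_subset[OF b] by (auto simp: R_def)
    show "mean n (\<lambda>z. of_bool (only e z) * (2 * of_bool (card {i\<in>R. z i} = m div 2 - ones b \<rho>))) =
        p1 * (2 * ((M choose (m div 2 - ones b \<rho>)) / 2 ^ M))"
      using mean_mult_indep[OF depends_of_bool[OF depends_only[OF e]] depR RX, of n]
      unfolding mean_only[OF e] mean_cmult mean_card_eq[OF finR Rn] cR .
  qed
  finally show ?thesis by simp
qed

end

section \<open>Term variables are queried late\<close>

lemma central_binomial_double: "(2 * (a + 1)) choose (a + 1) = 2 * ((2 * a + 1) choose a)"
proof -
  have "Suc a * (Suc (2 * a + 1) choose Suc a) = Suc (2 * a + 1) * ((2 * a + 1) choose a)"
    by (rule Suc_times_binomial)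
  also have "\<dots> = Suc a * (2 * ((2 * a + 1) choose a))" by (simp add: algebra_simps)
  finally have "Suc (2 * a + 1) choose Suc a = 2 * ((2 * a + 1) choose a)"
    unfolding mult_cancel1 by simp
  then show ?thesis by simp
qed

lemma central_binomial_Suc: "(a + 1) * ((2 * (a + 1)) choose (a + 1)) = 2 * (2 * a + 1) * ((2 * a) choose a)"
proof -
  have "(2 * a + 1) choose a = (2 * a + 1) choose Suc a"
    using binomial_symmetric[of a "2 * a + 1"] by simp
  then have "(a + 1) * (2 * ((2 * a + 1) choose a)) = 2 * (Suc a * (Suc (2 * a) choose Suc a))"
    by (simp del: binomial_Suc_Suc)
  also have "\<dots> = 2 * (Suc (2 * a) * ((2 * a) choose a))"
    by (simp only: Suc_times_binomial)
  finally show ?thesis unfolding central_binomial_double by (simp only: mult.assoc Suc_eq_plus1)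
qed

text \<open>The squared form of \<open>4 ^ a / (2 * sqrt a)\<close> as a lower bound keeps the
  induction free of roots; its step reduces to
  \<open>4 * a * (a + 1) \<le> (2 * a + 1)\<^sup>2\<close>.\<close>

lemma central_binomial_square_ge: "1 \<le> a \<Longrightarrow> 16 ^ a \<le> 4 * real a * ((2 * a) choose a)\<^sup>2"
proof (induction a rule: dec_induct)
  case base
  then show ?case by simp
next
  case (step a)
  define c c' where "c = real ((2 * a) choose a)" and "c' = real ((2 * (a + 1)) choose (a + 1))"
  have "real ((a + 1) * ((2 * (a + 1)) choose (a + 1))) = real (2 * (2 * a + 1) * ((2 * a) choose a))"
    by (subst central_binomial_Suc) simp
  then have c': "c' = 2 * (2 * a + 1) * c / (a + 1)"
    by (simp add: c_def c'_def field_simps)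
  have "16 ^ (a + 1) \<le> 16 * (4 * real a * c\<^sup>2)" using step by (simp add: c_def)
  also have "\<dots> * (a + 1) \<le> 16 * (2 * a + 1)\<^sup>2 * c\<^sup>2"
  proof -
    have "4 * real a * (a + 1) \<le> (2 * a + 1)\<^sup>2" by (simp add: power2_eq_square algebra_simps)
    then have "16 * c\<^sup>2 * (4 * real a * (a + 1)) \<le> 16 * c\<^sup>2 * (2 * a + 1)\<^sup>2"
      by (intro mult_left_mono) auto
    then show ?thesis by (simp add: algebra_simps)
  qed
  then have "16 * (4 * real a * c\<^sup>2) \<le> 16 * (2 * a + 1)\<^sup>2 * c\<^sup>2 / (a + 1)"
    by (simp add: field_simps)
  also have "\<dots> = 4 * real (a + 1) * c'\<^sup>2"
    unfolding c' by (simp add: power_divide power_mult_distrib power2_eq_square divide_simps) (simp add: algebra_simps)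
  finally show ?case by (simp add: c'_def)
qed

lemma central_binomial_ge:
  assumes "1 \<le> M"
  shows "2 ^ M \<le> 2 * sqrt M * (M choose (M div 2))"
proof -
  have even: "2 ^ (2 * a) \<le> 2 * sqrt a * ((2 * a) choose a)" if "1 \<le> a" for a :: nat
  proof (rule power2_le_imp_le)
    have "(2 ^ (2 * a))\<^sup>2 = (16::real) ^ a"
      by (simp add: power_mult power2_eq_square power_mult_distrib[symmetric])
    moreover have "(2 * sqrt a * ((2 * a) choose a))\<^sup>2 = 4 * real a * ((2 * a) choose a)\<^sup>2"
      by (simp add: power_mult_distrib)
    ultimately show "(2 ^ (2 * a))\<^sup>2 \<le> (2 * sqrt a * ((2 * a) choose a))\<^sup>2"
      using central_binomial_square_ge[OF that] by simp
  qed simp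
  show ?thesis
  proof (cases "even M")
    case True
    then obtain a where a: "M = 2 * a" by blast
    have "2 ^ M \<le> 2 * sqrt a * ((2 * a) choose a)" using even[of a] assms a by simp
    also have "\<dots> \<le> 2 * sqrt M * ((2 * a) choose a)"
      using a by (intro mult_right_mono mult_left_mono) auto
    finally show ?thesis using a by simp
  next
    case False
    then obtain a where a: "M = 2 * a + 1" by (auto elim: oddE)
    \<comment> \<open>The odd row is reached from the next even one, whose central coefficient is
      exactly twice as large.\<close>
    have "2 * 2 ^ M = (2::real) ^ (2 * (a + 1))" using a by simp
    also have "\<dots> \<le> 2 * sqrt (a + 1) * ((2 * (a + 1)) choose (a + 1))" using even[of "a + 1"] by simp
    also have "(2 * (a + 1)) choose (a + 1) = 2 * (M choose a)"
      unfolding central_binomial_double a ..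
    finally have "2 ^ M \<le> 2 * sqrt (a + 1) * (M choose a)" by (simp add: mult_ac)
    also have "\<dots> \<le> 2 * sqrt M * (M choose a)"
      using a by (intro mult_right_mono mult_left_mono) auto
    finally show ?thesis using a by simp
  qed
qed

text \<open>Moving from offset \<open>j\<close> to \<open>j + 1\<close> costs a factor of at least
  \<open>1 - 2 * (j + 1) / h\<close> with \<open>h = M div 2\<close>. The product of these factors
  is at least 1 minus the sum of the losses, which add up to \<open>j * (j + 1) / h\<close>.\<close>

lemma binomial_near_center_ge:
  assumes "j \<le> M div 2"
  shows "(M choose (M div 2)) * (1 - real j * (real j + 1) / real (M div 2)) \<le> real (M choose (M div 2 - j))"
  using assms
proof (induction j)
  case (Suc j)
  define h where "h = M div 2"
  define l where "l = h - Suc j"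
  define c where "c = real (M choose h)"
  have hj: "h - j = Suc l" "Suc j \<le> h" using Suc.prems by (auto simp: l_def h_def)
  have hpos: "0 < real h" using hj by simp
  have lM: "l \<le> M" "Suc l \<le> M" using hj by (auto simp: h_def)
  have IH: "c * (1 - real j * (real j + 1) / real h) \<le> real (M choose Suc l)"
    using Suc.IH[OF Suc_leD[OF Suc.prems]] unfolding h_def[symmetric] hj(1) c_def .
  have "Suc l * (M choose Suc l) = (M - l) * (M choose l)"
    unfolding binomial_absorption binomial_absorb_comp ..
  then have "real (Suc l) * (M choose Suc l) = real (M - l) * (M choose l)"
    by (metis of_nat_mult)
  then have eq: "real (M choose l) = (M choose Suc l) * (Suc l / (M - l))"
    using lM by (simp add: field_simps)
  have "1 - 2 * (real j + 1) / h \<le> Suc l / (M - l)"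
  proof -
    \<comment> \<open>\<open>M\<close> may be odd, hence \<open>h + j + 2\<close> and not
      \<open>h + j + 1\<close>.\<close>
    have le: "real (M - l) \<le> h + j + 2" unfolding l_def h_def using hj by linarith
    have pos: "0 < real (M - l)" using lM by simp
    have "(h - 2 * (real j + 1)) * (M - l) \<le> real h * real (Suc l)"
    proof (cases "h - 2 * (real j + 1) \<le> 0")
      case True
      then have "(h - 2 * (real j + 1)) * (M - l) \<le> 0" using pos by (simp add: mult_nonpos_nonneg)
      also have "0 \<le> real h * Suc l" by simp
      finally show ?thesis .
    next
      case False
      then have "(h - 2 * (real j + 1)) * (M - l) \<le> (h - 2 * (real j + 1)) * (h + j + 2)"
        using le by (intro mult_left_mono) auto
      also have "\<dots> \<le> h * (real h - j)" by (simp add: algebra_simps)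
      also have "real h - j = Suc l" using hj by linarith
      finally show ?thesis .
    qed
    then show ?thesis using pos hpos by (simp add: field_simps)
  qed
  show ?case
  proof (cases "1 - real (Suc j) * (real (Suc j) + 1) / real h \<le> 0")
    case True
    then have "c * (1 - real (Suc j) * (real (Suc j) + 1) / real h) \<le> 0"
      by (intro mult_nonneg_nonpos) (auto simp: c_def)
    then show ?thesis using of_nat_0_le_iff by (simp add: c_def h_def order_trans)
  next
    case False
    define A A' where "A = real j * (real j + 1) / real h" and "A' = 2 * (real j + 1) / h"
    have nn: "0 \<le> A" "0 \<le> A'" using hpos by (auto simp: A_def A'_def)
    have sum: "real (Suc j) * (real (Suc j) + 1) / real h = A + A'"
      unfolding A_def A'_def using hpos by (simp add: field_simps)
    have "c * (1 - (A + A')) \<le> c * ((1 - A) * (1 - A'))"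
      using nn by (intro mult_left_mono) (auto simp: algebra_simps c_def)
    also have "\<dots> = (c * (1 - A)) * (1 - A')" by simp
    also have "\<dots> \<le> real (M choose Suc l) * (1 - A')"
    proof (rule mult_right_mono)
      show "c * (1 - A) \<le> real (M choose Suc l)" using IH unfolding A_def .
      show "0 \<le> 1 - A'" using False nn unfolding sum by simp
    qed
    also have "\<dots> \<le> real (M choose Suc l) * (Suc l / (M - l))"
      using \<open>1 - 2 * (real j + 1) / h \<le> Suc l / (M - l)\<close> by (intro mult_left_mono) (auto simp: A'_def)
    also have "\<dots> = real (M choose l)" by (rule eq[symmetric])
    finally show ?thesis by (simp only: sum[symmetric] c_def l_def h_def)
  qed
qed simp

text \<open>At distance at most \<open>sqrt M / 4\<close> from the centre a coefficient is at least
  half the central one; symmetry covers \<open>k\<close> above the centre.\<close>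

lemma binomial_ge:
  assumes M: "1 \<le> M" and k: "4 * (real M - 2 * real k)\<^sup>2 \<le> M"
  shows "2 ^ M \<le> 4 * sqrt M * (M choose k)"
proof -
  have *: "2 ^ M \<le> 4 * sqrt M * (M choose k)"
    if k: "4 * (real M - 2 * real k)\<^sup>2 \<le> M" and le: "k \<le> M div 2" for k
  proof -
    define j where "j = M div 2 - k"
    \<comment> \<open>For \<open>j > 0\<close> the numerator is at most
      \<open>2 * j\<^sup>2 \<le> M / 8\<close>, and \<open>M div 2\<close> is at least
      \<open>M / 4\<close>.\<close>
    have "real j * (real j + 1) / real (M div 2) \<le> 1 / 2"
    proof (cases "j = 0")
      case False
      have "2 * real j \<le> real M - 2 * real k" unfolding j_def using le by linarith
      then have "(2 * real j)\<^sup>2 \<le> (real M - 2 * real k)\<^sup>2" by (intro power_mono) auto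
      then have M16: "16 * (real j)\<^sup>2 \<le> M" using k by (simp add: power2_eq_square)
      have jj: "real j * (real j + 1) \<le> 2 * (real j)\<^sup>2"
        using False by (simp add: power2_eq_square algebra_simps)
      have "1 \<le> (real j)\<^sup>2" using False by simp
      then have "16 \<le> M" using M16 by linarith
      then have "real M / 4 \<le> real (M div 2)" by linarith
      then show ?thesis using M16 jj \<open>16 \<le> M\<close> by (simp add: field_simps)
    qed simp
    then have "(M choose (M div 2)) * (1 / 2) \<le> (M choose (M div 2)) * (1 - real j * (real j + 1) / real (M div 2))"
      by (intro mult_left_mono) auto
    also have "\<dots> \<le> real (M choose (M div 2 - j))"
      by (intro binomial_near_center_ge) (simp add: j_def)
    also have "M div 2 - j = k" using le by (simp add: j_def)
    finally have "(M choose (M div 2)) * (1 / 2) \<le> real (M choose k)" .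
    then have "4 * sqrt M * ((M choose (M div 2)) * (1 / 2)) \<le> 4 * sqrt M * (M choose k)"
      by (intro mult_left_mono) auto
    then show ?thesis using central_binomial_ge[OF M] by simp
  qed
  show ?thesis
  proof (cases "k \<le> M div 2")
    case False
    have "k \<le> M"
    proof (rule ccontr)
      assume "\<not> k \<le> M"
      then have "real M \<le> 2 * real k - real M" by linarith
      then have "(real M)\<^sup>2 \<le> (2 * real k - real M)\<^sup>2" by (intro power_mono) auto
      then have "4 * (real M)\<^sup>2 \<le> M" using k by (simp add: power2_commute)
      moreover have "real M \<le> (real M)\<^sup>2" using M by (simp add: power2_eq_square)
      ultimately show False using M by linarith
    qed
    then have "M choose k = M choose (M - k)" by (rule binomial_symmetric)
    moreover have "(real M - 2 * real (M - k))\<^sup>2 = (real M - 2 * real k)\<^sup>2"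
      using \<open>k \<le> M\<close> by (simp add: of_nat_diff power2_eq_square algebra_simps)
    moreover have "M - k \<le> M div 2" using False by linarith
    ultimately show ?thesis using *[of "M - k"] k by simp
  qed (use * k in blast)
qed

lemma tree_size_pos: "1 \<le> tree_size T"
  by (induction T) auto

context term_selected_majority
begin

text \<open>A block that has lost few variables to an almost balanced set of answers still has
  influential variables, so a term variable can be queried only after \<open>\<Phi>\<close> has become large.\<close>

lemma \<Phi>_ge:
  assumes K: "1 \<le> K" and d: "32 * K * real d \<le> real (B * m)" and m3: "3 \<le> m"
    and g: "128 * sqrt m < real (D div B)" and q16: "1 / 16 \<le> (1 - q) ^ (D - 1)"
    and \<rho>: "fst ` set \<rho> \<inter> X = {}" "length \<rho> \<le> d" and i: "i \<in> X"
    and max: "\<And>j. j < n \<Longrightarrow> infl n (restrict_path f \<rho>) j \<le> infl n (restrict_path f \<rho>) i"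
  shows "K * d \<le> \<Phi> \<rho>"
proof (rule ccontr)
  assume "\<not> K * d \<le> \<Phi> \<rho>"
  then have \<Phi>: "\<Phi> \<rho> < K * d" by simp
  define t where "t = (\<lambda>b. ones b \<rho> + zeros b \<rho>)"
  define S where "S = (\<lambda>b. (real (ones b \<rho>) - real (zeros b \<rho>))\<^sup>2)"
  \<comment> \<open>Averaging over blocks: queries and squared imbalances together sum to less than
    \<open>2 * K * d\<close>, which is at most \<open>B * m / 16\<close>.\<close>
  have "\<exists>b<B. t b + S b \<le> m / 16"
  proof (rule ccontr)
    assume "\<not> (\<exists>b<B. t b + S b \<le> m / 16)"
    then have "(\<Sum>b<B. m / 16) \<le> (\<Sum>b<B. real (t b) + S b)"
      by (intro sum_mono) (auto simp: not_le intro: less_imp_le)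
    also have "\<dots> = real (\<Sum>b<B. t b) + \<Phi> \<rho>"
      by (simp add: sum.distrib \<Phi>_def S_def)
    also have "\<dots> < K * d + K * d"
    proof -
      have "real (\<Sum>b<B. t b) \<le> real d"
        using sum_queries_le[of \<rho>] \<rho>(2) unfolding t_def by (intro of_nat_mono) linarith
      also have "\<dots> \<le> K * d" using mult_right_mono[OF K, of "real d"] by simp
      finally show ?thesis using \<Phi> by linarith
    qed
    finally show False using d by simp
  qed
  then obtain b where b: "b < B" and tb: "t b + S b \<le> m / 16" by blast
  have S0: "0 \<le> S b" by (simp add: S_def)
  have t16: "real (t b) \<le> m / 16" and S16: "S b \<le> m / 16" using tb S0 by linarith+
  have tm: "16 * t b \<le> m" using t16 by linarith
  have "\<not> yvars b \<subseteq> fst ` set \<rho>"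
  proof
    assume "yvars b \<subseteq> fst ` set \<rho>"
    then have "t b = m" unfolding t_def ones_plus_zeros by (simp add: Int_absorb2 card_yvars)
    then show False using tm m3 by simp
  qed
  then obtain j where j: "j \<in> yvars b" "j \<notin> fst ` set \<rho>" by blast
  have u: "ones b \<rho> \<le> m div 2" using tm unfolding t_def by (simp add: less_eq_div_iff_mult_less_eq)
  define M where "M = m - 1 - t b"
  define k where "k = m div 2 - ones b \<rho>"
  have M2: "real m / 2 \<le> real M" using tm m3 unfolding M_def by linarith
  have M1: "1 \<le> M" using M2 m3 by linarith
  \<comment> \<open>The pivotal count is off centre by half the imbalance of the block, so a small
    \<open>S b\<close> puts it in the range of \<open>binomial_ge\<close>.\<close>
  have "real M - 2 * real k = real (ones b \<rho>) - real (zeros b \<rho>)"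
  proof -
    obtain h where h: "m = 2 * h + 1" using m by (auto elim: oddE)
    then have "real k = real h - real (ones b \<rho>)" using u by (simp add: k_def of_nat_diff)
    moreover have "real M = 2 * real h - real (t b)" using tm m3 h unfolding M_def by linarith
    ultimately show ?thesis by (simp add: t_def)
  qed
  then have "4 * (real M - 2 * real k)\<^sup>2 \<le> M" using S16 M2 by (simp add: S_def)
  from binomial_ge[OF M1 this] have "2 ^ M \<le> 4 * sqrt M * (M choose k)" .
  also have "\<dots> \<le> 4 * sqrt m * (M choose k)"
    by (intro mult_right_mono mult_left_mono) (auto simp: M_def)
  finally have piv: "1 \<le> 4 * sqrt m * ((M choose k) / 2 ^ M)" by (simp add: field_simps)
  define P where "P = (M choose k) / 2 ^ M"
  have sm: "0 < sqrt m" using m3 by simp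
  have P: "1 / (4 * sqrt m) \<le> P" using piv sm by (simp add: P_def field_simps)
  \<comment> \<open>The factor 128 is 4 from the term side, times 16 from
    \<open>q / 16 \<le> p1\<close>, times 2 from
    \<open>2 * P \<ge> 1 / (2 * sqrt m)\<close>.\<close>
  have "4 * q = 128 * sqrt m * (q / 16) * (2 * (1 / (4 * sqrt m)))" using sm by simp
  also have "\<dots> < real (D div B) * (q / 16) * (2 * (1 / (4 * sqrt m)))"
    using g q_bounds sm by (intro mult_strict_right_mono) auto
  also have "\<dots> \<le> card {e. e < D \<and> e mod B = b} * p1 * (2 * P)"
  proof (intro mult_mono)
    show "real (D div B) \<le> real (card {e. e < D \<and> e mod B = b})"
      using card_residue_class_ge[OF b] by simp
    show "q / 16 \<le> p1"
      using mult_left_mono[OF q16, of q] q_bounds by (simp add: p1_def)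
  qed (use P sm q_bounds p1_bounds in auto)
  also have "\<dots> = infl n (restrict_path f \<rho>) j"
    unfolding infl_yvars_eq[OF \<rho>(1) b j u] P_def M_def k_def t_def by simp
  also have "\<dots> \<le> infl n (restrict_path f \<rho>) i"
    using yvars_subset[OF b] j by (intro max) auto
  also have "\<dots> \<le> 4 * q" by (rule infl_X_le[OF \<rho>(1) i])
  finally show False by simp
qed

section \<open>Probability that a greedy tree meets a term variable\<close>

lemma hit_indep: "tree_over V T \<Longrightarrow> i \<notin> V \<Longrightarrow> hit T (z(i := c)) = hit T z"
  by (induction T arbitrary: V) (simp_all, (metis DiffE)+)

text \<open>The first summand pays for paths that reach depth \<open>d\<close>, the second is
  Markov's inequality at the first term variable: \<Phi> plus the remaining budget
  \<open>d - length \<rho>\<close> is a supermartingale. Both summands are compatible with averaging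
  over the two subtrees, which drives the induction.\<close>

lemma hit_prob_le_aux:
  assumes K: "1 \<le> K" and d: "32 * K * real d \<le> real (B * m)" "1 \<le> d" and m3: "3 \<le> m"
    and g: "128 * sqrt m < real (D div B)" and q16: "1 / 16 \<le> (1 - q) ^ (D - 1)"
  shows "tree_over V T \<Longrightarrow> V \<subseteq> {..<n} \<Longrightarrow> V \<inter> fst ` set \<rho> = {} \<Longrightarrow> fst ` set \<rho> \<inter> X = {} \<Longrightarrow>
    length \<rho> \<le> d \<Longrightarrow> greedy n (restrict_path f \<rho>) T \<Longrightarrow>
    mean n (\<lambda>z. of_bool (hit T z)) \<le>
      tree_size T / 2 ^ (d - length \<rho>) + (\<Phi> \<rho> + (d - length \<rho>)) / (K * d)"
proof (induction T arbitrary: V \<rho>)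
  case (Leaf a)
  have "0 \<le> (\<Phi> \<rho> + (d - length \<rho>)) / (K * d)"
    using \<Phi>_nonneg K Leaf by (intro divide_nonneg_nonneg add_nonneg_nonneg) auto
  then show ?case by (simp add: mean_const)
next
  case (Query i l r)
  have Kd: "0 < K * d" using K d by simp
  have le1: "mean n (\<lambda>z. of_bool (hit (Query i l r) z)) \<le> 1"
    using mean_mono[of n "\<lambda>z. of_bool (hit (Query i l r) z)" "\<lambda>_. 1"] by (simp add: mean_const)
  have nn: "0 \<le> (\<Phi> \<rho> + (d - length \<rho>)) / (K * d)"
    using \<Phi>_nonneg Kd by (intro divide_nonneg_nonneg add_nonneg_nonneg) auto
  have i: "i \<in> V" "i < n" "i \<notin> fst ` set \<rho>" using Query.prems by auto
  consider "length \<rho> = d" | "length \<rho> < d" "i \<in> X" | "length \<rho> < d" "i \<notin> X"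
    using Query.prems(5) by linarith
  then show ?case
  proof cases
    \<comment> \<open>The depth budget is exhausted and the size summand alone reaches 1.\<close>
    case 1
    have "1 \<le> real (tree_size (Query i l r)) / 2 ^ (d - length \<rho>)"
      using tree_size_pos[of "Query i l r"] 1 by simp
    then show ?thesis using le1 nn by linarith
  next
    \<comment> \<open>A term variable before depth \<open>d\<close> forces
      \<open>K * d \<le> \<Phi> \<rho>\<close>, so the potential summand alone reaches 1.\<close>
    case 2
    have "K * d \<le> \<Phi> \<rho>"
      using Query.prems 2 by (intro \<Phi>_ge[OF K d(1) m3 g q16]) auto
    then have "1 \<le> (\<Phi> \<rho> + (d - length \<rho>)) / (K * d)" using Kd by (simp add: field_simps)
    moreover have "0 \<le> tree_size (Query i l r) / (2::real) ^ (d - length \<rho>)" by simp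
    ultimately show ?thesis using le1 by linarith
  next
    case 3
    define \<rho>' where "\<rho>' = (\<lambda>c. \<rho> @ [(i, c)])"
    have len: "d - length \<rho> = Suc (d - length (\<rho>' c))" for c using 3 by (simp add: \<rho>'_def)
    define e where "e = d - Suc (length \<rho>)"
    have e: "d - length (\<rho>' c) = e" "d - length \<rho> = Suc e" for c using 3 by (auto simp: \<rho>'_def e_def)
    have res: "restrict_path f (\<rho>' c) = (\<lambda>x. restrict_path f \<rho> (x(i := c)))" for c
      by (simp add: \<rho>'_def restrict_path_append)
    have side: "V - {i} \<subseteq> {..<n}" "(V - {i}) \<inter> fst ` set (\<rho>' c) = {}"
      "fst ` set (\<rho>' c) \<inter> X = {}" "length (\<rho>' c) \<le> d" for c
      using Query.prems 3 by (auto simp: \<rho>'_def)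
    have tl: "tree_over (V - {i}) l" and tr: "tree_over (V - {i}) r" using Query.prems by auto
    have gl: "greedy n (restrict_path f (\<rho>' False)) l" and gr: "greedy n (restrict_path f (\<rho>' True)) r"
      using Query.prems unfolding res by auto
    have bl: "mean n (\<lambda>z. of_bool (hit l z)) \<le> tree_size l / 2 ^ e + (\<Phi> (\<rho>' False) + e) / (K * d)"
      using Query.IH(1)[OF tl side gl] unfolding e .
    have br: "mean n (\<lambda>z. of_bool (hit r z)) \<le> tree_size r / 2 ^ e + (\<Phi> (\<rho>' True) + e) / (K * d)"
      using Query.IH(2)[OF tr side gr] unfolding e .
    have half: "((a / p + x / c) + (b / p + y / c)) / 2 = (a + b) / (2 * p) + (x + y) / (2 * c)"
      for a b c p x y :: real
      by (simp add: add_divide_distrib)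
    have "mean n (\<lambda>z. of_bool (hit (Query i l r) z)) =
        (mean n (\<lambda>z. of_bool (hit l z)) + mean n (\<lambda>z. of_bool (hit r z))) / 2"
      using hit_indep[OF tl, of i] hit_indep[OF tr, of i] 3
      by (subst mean_split[OF i(2)]) simp
    also have "\<dots> \<le> ((tree_size l / 2 ^ e + (\<Phi> (\<rho>' False) + e) / (K * d)) +
        (tree_size r / 2 ^ e + (\<Phi> (\<rho>' True) + e) / (K * d))) / 2"
      by (intro divide_right_mono add_mono bl br) simp
    also have "\<dots> = tree_size (Query i l r) / 2 ^ Suc e +
        (\<Phi> (\<rho>' False) + \<Phi> (\<rho>' True) + 2 * e) / (2 * (K * d))"
      unfolding half by (simp add: algebra_simps)
    also have "\<dots> \<le> tree_size (Query i l r) / 2 ^ Suc e + (2 * (\<Phi> \<rho> + Suc e)) / (2 * (K * d))"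
      using \<Phi>_snoc[OF i(3)] Kd by (intro add_left_mono divide_right_mono) (auto simp: \<rho>'_def)
    also have "\<dots> = tree_size (Query i l r) / 2 ^ Suc e + (\<Phi> \<rho> + Suc e) / (K * d)"
      unfolding mult_divide_mult_cancel_left_if by simp
    finally show ?thesis unfolding e .
  qed
qed

lemma greedy_size_ge:
  assumes K: "1 \<le> K" and d: "32 * K * real d \<le> real (B * m)" "1 \<le> d" and m3: "3 \<le> m"
    and g: "128 * sqrt m < real (D div B)" and q16: "1 / 16 \<le> (1 - q) ^ (D - 1)"
    and T: "greedy n f T" "tree_over {..<n} T"
  shows "1 / 2 - tree_error n f (completion n f T)
     - (\<bar>1 - 2 * (1 - q) ^ D - D * p1\<bar> + q * sqrt (D * (D / B + 1))) / 2
     \<le> tree_size T / 2 ^ d + 1 / K"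
proof -
  \<comment> \<open>At the root the potential summand is \<open>d / (K * d)\<close>.\<close>
  have "\<Phi> [] = 0" by (simp add: \<Phi>_def ones_def zeros_def)
  then have "mean n (\<lambda>z. of_bool (hit T z)) \<le> tree_size T / 2 ^ d + 1 / K"
    using hit_prob_le_aux[OF K d m3 g q16, of "{..<n}" T "[]"] T d(2) K by simp
  with hit_prob_ge[of T] show ?thesis by linarith
qed

end

lemma tree_size_completion: "tree_size (completion n f T) = tree_size T"
  by (induction T arbitrary: f) auto

section \<open>Choice of the parameters\<close>

text \<open>The number of terms is chosen so that having no satisfied term and having at least two
  of them are almost equally likely; adding one term changes the difference of these two
  probabilities by at most \<open>q\<close>.\<close>

lemma balanced_term_count:
  fixes w :: nat
  assumes w: "1 \<le> w"
  defines "q \<equiv> 1 / 2 ^ w :: real"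
  shows "\<exists>D. 2 ^ w \<le> 2 * D \<and> D \<le> 2 * 2 ^ w \<and> 1 / 16 \<le> (1 - q) ^ (D - 1) \<and>
    \<bar>1 - 2 * (1 - q) ^ D - real D * (q * (1 - q) ^ (D - 1))\<bar> \<le> q"
proof -
  define N :: nat where "N = 2 ^ w"
  define r where "r = 1 - q"
  \<comment> \<open>\<open>F D\<close> is the probability of at least two satisfied terms minus that
    of none.\<close>
  define F where "F = (\<lambda>D. 1 - 2 * r ^ D - real D * (q * r ^ (D - 1)))"
  have q: "0 < q" "q \<le> 1 / 2" "q * N = 1"
    using w power_increasing[of 1 w "2::real"] by (auto simp: q_def N_def field_simps)
  have r: "1 / 2 \<le> r" "r < 1" "0 \<le> r" using q by (auto simp: r_def)
  have N2: "2 \<le> N" using w power_increasing[of 1 w "2::nat"] by (simp add: N_def)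
  \<comment> \<open>With \<open>2 * N\<close> terms two are satisfied on average, and
    \<open>r ^ N \<le> exp (- 1) \<le> 2 / 5\<close> suffices for the sign.\<close>
  have "0 \<le> F (2 * N)"
  proof -
    have "5 / 2 \<le> exp (1::real)" using exp_lower_Taylor_quadratic[of "1::real"] by simp
    then have "exp (- 1 :: real) \<le> 2 / 5" by (simp add: exp_minus field_simps)
    moreover have "r ^ N \<le> exp (- 1)"
    proof -
      have "r ^ N \<le> exp (- q) ^ N"
        using exp_ge_add_one_self[of "- q"] r by (intro power_mono) (auto simp: r_def)
      also have "\<dots> = exp (- 1)" using q(3) by (simp add: exp_of_nat_mult[symmetric] mult.commute)
      finally show ?thesis .
    qed
    ultimately have "r ^ N \<le> 2 / 5" by linarith
    then have "(r ^ N)\<^sup>2 \<le> (2 / 5)\<^sup>2" using r by (intro power_mono) auto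
    then have sq: "r ^ (2 * N) \<le> 4 / 25"
      by (simp add: power2_eq_square mult_2 power_add)
    have "r * r ^ (2 * N - 1) = r ^ (2 * N)" using N2 by (simp add: power_eq_if)
    moreover have "(1 / 2) * r ^ (2 * N - 1) \<le> r * r ^ (2 * N - 1)"
      using r by (intro mult_right_mono) auto
    ultimately have "r ^ (2 * N - 1) \<le> 8 / 25" using sq by linarith
    moreover have "real (2 * N) * (q * r ^ (2 * N - 1)) = 2 * r ^ (2 * N - 1)"
      using q(3) by (simp add: algebra_simps)
    ultimately show ?thesis using sq unfolding F_def by linarith
  qed
  \<comment> \<open>The first sign change of \<open>F\<close>, so that \<open>F D\<close> exceeds 0
    by at most one increment.\<close>
  moreover define D where "D = (LEAST D. 0 \<le> F D)"
  ultimately have FD: "0 \<le> F D" and DN: "D \<le> 2 * N" and less: "\<And>E. E < D \<Longrightarrow> F E < 0"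
    by (auto simp: not_le[symmetric] intro: LeastI Least_le dest: not_less_Least)
  have D1: "1 \<le> D"
  proof (rule ccontr)
    assume "\<not> 1 \<le> D"
    then have "D = 0" by simp
    then show False using FD by (simp add: F_def)
  qed
  have "F D \<le> q"
  proof -
    define E where "E = D - 1"
    have E: "D = Suc E" using D1 by (simp add: E_def)
    have "F (Suc E) - F E \<le> q"
    proof (cases E)
      case 0
      then show ?thesis by (simp add: F_def r_def)
    next
      case (Suc k)
      \<comment> \<open>By Bernoulli's inequality the bracket is at most
        \<open>((1 - q) * (1 + q)) ^ k \<le> 1\<close>.\<close>
      have "F (Suc E) - F E = q * (r ^ k * (1 + real k * q))"
      proof -
        have "F (Suc E) - F E = r ^ k * (2 * r - 2 * r * r - real (k + 2) * q * r + real (k + 1) * q)"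
          unfolding F_def Suc by (simp add: algebra_simps)
        also have "2 * r - 2 * r * r - real (k + 2) * q * r + real (k + 1) * q = q * (1 + real k * q)"
          unfolding r_def by (simp add: algebra_simps)
        finally show ?thesis by simp
      qed
      also have "r ^ k * (1 + real k * q) \<le> r ^ k * (1 + q) ^ k"
        using Bernoulli_inequality[of q k] q r by (intro mult_left_mono) auto
      also have "\<dots> = (r * (1 + q)) ^ k" by (simp add: power_mult_distrib)
      also have "\<dots> \<le> 1"
      proof (rule power_le_one)
        show "0 \<le> r * (1 + q)" using q r by simp
        show "r * (1 + q) \<le> 1" using q by (simp add: r_def algebra_simps)
      qed
      finally show ?thesis using q by simp
    qed
    moreover have "F E < 0" using less E by simp
    ultimately show ?thesis unfolding E by linarith
  qed
  then have "\<bar>F D\<bar> \<le> q" using FD by simp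
  moreover have "N \<le> 2 * D"
  proof (rule ccontr)
    assume "\<not> N \<le> 2 * D"
    \<comment> \<open>\<open>l\<close> is the expected number of satisfied terms; below 1/2 it would
      give \<open>F D \<le> l + l * l - 1 < 0\<close>.\<close>
    define l where "l = real D * q"
    have "real (2 * D) * q < real N * q"
      using \<open>\<not> N \<le> 2 * D\<close> q by (intro mult_strict_right_mono) auto
    then have l: "0 \<le> l" "l < 1 / 2" using q by (auto simp: l_def mult.commute)
    have "1 - l \<le> r ^ D" using Bernoulli_inequality[of "- q" D] q by (simp add: r_def l_def)
    moreover have "1 - l \<le> r ^ (D - 1)"
      using Bernoulli_inequality[of "- q" "D - 1"] q D1 by (simp add: r_def l_def of_nat_diff algebra_simps)
    then have "l * (1 - l) \<le> l * r ^ (D - 1)" using l by (intro mult_left_mono) auto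
    moreover have "F D = 1 - 2 * r ^ D - l * r ^ (D - 1)" by (simp add: F_def l_def)
    moreover have "l * l < 1 / 2 * (1 / 2)" using l by (intro mult_strict_mono') auto
    ultimately show False using FD l by (simp add: algebra_simps)
  qed
  moreover have "1 / 16 \<le> r ^ (D - 1)"
  proof -
    obtain v where v: "w = Suc v" using w by (cases w) auto
    \<comment> \<open>Since \<open>q * H = 1 / 2\<close>, Bernoulli's inequality gives
      \<open>r ^ H \<ge> 1 / 2\<close>, and \<open>D - 1\<close> is at most
      \<open>4 * H\<close>.\<close>
    define H :: nat where "H = 2 ^ v"
    have H: "N = 2 * H" by (simp add: N_def H_def v)
    have "1 / 2 \<le> r ^ H"
      using Bernoulli_inequality[of "- q" H] q H by (simp add: r_def algebra_simps)
    then have "(1 / 2) ^ 4 \<le> (r ^ H) ^ 4" by (intro power_mono) auto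
    also have "\<dots> = r ^ (2 * N)" by (simp add: H power_mult[symmetric] mult.commute)
    also have "\<dots> \<le> r ^ (D - 1)" using DN r by (intro power_decreasing) auto
    finally show ?thesis by (simp add: power_divide)
  qed
  ultimately show ?thesis using DN unfolding F_def r_def N_def by blast
qed

lemma hard_function:
  fixes \<epsilon> \<kappa> :: real and w m B n d s :: nat
  defines "\<kappa> \<equiv> 1 / 2 - \<epsilon>"
  assumes \<epsilon>: "0 < \<epsilon>" "\<epsilon> < 1 / 2" and w: "1 \<le> w" and m_odd: "odd m" and m3: "3 \<le> m" and B: "1 \<le> B"
    and d: "1 \<le> d" "128 * real d \<le> \<kappa> * (real B * real m)"
    and n: "2 * 2 ^ w * real w + real B * real m \<le> real n"
    and s: "1 \<le> s" "2 * 2 ^ w * real w + real m \<le> log 2 s"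
    and g: "128 * sqrt m + 1 \<le> 2 ^ w / (2 * real B)"
    and small: "1 / 2 ^ w \<le> \<kappa> / 4" "4 / real B + 2 / 2 ^ w \<le> \<kappa>\<^sup>2 / 16"
  shows "\<exists>f. sign_valued n f \<and> monotone_fun n f \<and> computable_with_size n f s \<and>
    (\<forall>G T. impurity_function G \<longrightarrow> builds G \<epsilon> n f T \<longrightarrow> \<kappa> / 2 * 2 ^ d \<le> tree_size T)"
proof -
  define Q where "Q = (1 / 2 ^ w :: real)"
  obtain D where D: "2 ^ w \<le> 2 * D" "D \<le> 2 * 2 ^ w" "1 / 16 \<le> (1 - Q) ^ (D - 1)"
    "\<bar>1 - 2 * (1 - Q) ^ D - real D * (Q * (1 - Q) ^ (D - 1))\<bar> \<le> Q"
    using balanced_term_count[OF w] unfolding Q_def by blast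
  have Dr: "2 ^ w \<le> 2 * real D" "real D \<le> 2 * 2 ^ w"
    using of_nat_mono[OF D(1), where 'a = real] of_nat_mono[OF D(2), where 'a = real] by auto
  have Dw: "real D * real w \<le> 2 * 2 ^ w * real w" using Dr by (intro mult_right_mono) auto
  have "real (D * w + B * m) \<le> real n" using n Dw by simp
  then have "D * w + B * m \<le> n" by (simp only: of_nat_le_iff)
  with w m_odd B interpret term_selected_majority w D m B n
    by unfold_locales
  have qeq: "q = Q" by (simp add: q_def Q_def)
  have "sign_valued n f"
    using sign_fun_f by (simp add: sign_valued_def sign_fun_def)
  moreover have "monotone_fun n f"
    unfolding monotone_fun_def
  proof (intro ballI impI)
    fix x y assume xy: "x \<in> cube n" "y \<in> cube n" "\<forall>i<n. x i \<le> y i"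
    \<comment> \<open>Beyond \<open>n\<close> both points of the cube take the same default
      value.\<close>
    have "x i \<le> y i" for i
      using xy by (cases "i < n") (auto simp: cube_def PiE_def extensional_def)
    then show "f x \<le> f y" by (intro monoD[OF mono_f]) (simp add: le_fun_def)
  qed
  moreover have "computable_with_size n f s"
  proof -
    have "2 powr real (D * w + m) \<le> 2 powr log 2 s"
      using s Dw by (intro powr_mono) auto
    then have "(2::real) ^ (D * w + m) \<le> real s"
      using s powr_realpow[of 2 "D * w + m"] by simp
    then have "real (2 ^ (D * w + m)) \<le> real s" by simp
    then have "2 ^ (D * w + m) \<le> s" by (simp only: of_nat_le_iff)
    then show ?thesis using computable_f unfolding computable_with_size_def by (meson le_trans)
  qed
  moreover have "\<kappa> / 2 * 2 ^ d \<le> tree_size T" if G: "impurity_function G" and T: "builds G \<epsilon> n f T" for G T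
  proof -
    obtain A where A: "reachable G \<epsilon> n f A" "T = completion n f A" "tree_error n f T \<le> \<epsilon>"
      using T unfolding builds_def by blast
    have gr: "greedy n f A" "tree_over {..<n} A"
      using reachable_greedy[OF A(1) G sign_fun_f mono_f] by auto
    have \<kappa>: "0 < \<kappa>" "\<kappa> \<le> 1 / 2" using \<epsilon> by (auto simp: \<kappa>_def)
    \<comment> \<open>With \<open>K = 4 / \<kappa>\<close> the Markov summand costs a quarter of the
      advantage \<kappa>.\<close>
    have K: "1 \<le> 4 / \<kappa>" using \<kappa> by (simp add: field_simps)
    have d': "32 * (4 / \<kappa>) * real d \<le> real (B * m)" using d \<kappa> by (simp add: field_simps)
    have g': "128 * sqrt m < real (D div B)"
    proof -
      have "2 ^ w / (2 * real B) \<le> real D / real B" using Dr B by (simp add: field_simps)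
      moreover have "real D / real B < real (D div B) + 1"
      proof -
        have "D < (D div B + 1) * B" using B by (metis add.commute dividend_less_div_times less_le_trans mult_Suc plus_1_eq_Suc zero_less_one)
        then have "real D < real ((D div B + 1) * B)" by (simp only: of_nat_less_iff)
        then show ?thesis using B by (simp add: field_simps)
      qed
      ultimately show ?thesis using g by linarith
    qed
    have "1 / 2 - tree_error n f (completion n f A)
        - (\<bar>1 - 2 * (1 - Q) ^ D - D * (Q * (1 - Q) ^ (D - 1))\<bar> + Q * sqrt (D * (D / B + 1))) / 2
        \<le> tree_size A / 2 ^ d + 1 / (4 / \<kappa>)"
      using greedy_size_ge[OF K d' d(1) m3 g' _ gr] D(3) unfolding qeq p1_def .
    moreover have "Q * sqrt (D * (D / B + 1)) \<le> \<kappa> / 4"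
    proof -
      have q0: "0 \<le> Q" by (simp add: Q_def)
      have qD: "Q * D \<le> 2" using Dr by (simp add: Q_def field_simps)
      \<comment> \<open>After squaring, \<open>Q * D \<le> 2\<close> yields exactly the two summands
        bounded in \<open>small(2)\<close>.\<close>
      have "(Q * sqrt (D * (D / B + 1)))\<^sup>2 = (Q * D) * (Q * D) / B + Q * (Q * D)"
        by (simp add: power_mult_distrib power2_eq_square field_simps)
      also have "\<dots> \<le> 2 * 2 / B + Q * 2"
        using qD q0 by (intro add_mono divide_right_mono mult_mono) auto
      also have "\<dots> \<le> \<kappa>\<^sup>2 / 16" using small(2) by (simp add: Q_def)
      also have "\<dots> = (\<kappa> / 4)\<^sup>2" by (simp add: power_divide)
      finally have "(Q * sqrt (D * (D / B + 1)))\<^sup>2 \<le> (\<kappa> / 4)\<^sup>2" .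
      then show ?thesis by (rule power2_le_imp_le) (use \<kappa> in simp)
    qed
    moreover have "\<bar>1 - 2 * (1 - Q) ^ D - D * (Q * (1 - Q) ^ (D - 1))\<bar> \<le> \<kappa> / 4"
      using D(4) small(1) by (simp add: Q_def)
    moreover have "tree_error n f (completion n f A) \<le> 1 / 2 - \<kappa>"
      using A by (simp add: \<kappa>_def)
    moreover have "1 / (4 / \<kappa>) = \<kappa> / 4" by simp
    \<comment> \<open>The balance is \<kappa>, minus half of
      \<open>\<kappa> / 4 + \<kappa> / 4\<close> for the correlation, minus
      \<open>\<kappa> / 4\<close> for Markov.\<close>
    ultimately have "\<kappa> / 2 \<le> tree_size A / 2 ^ d" by argo
    then have "\<kappa> / 2 * 2 ^ d \<le> tree_size A" by (simp add: field_simps)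
    then show ?thesis using A(2) by (simp add: tree_size_completion)
  qed
  ultimately show ?thesis by blast
qed

section \<open>Scaling of the parameters with the logarithm of the size\<close>

lemma real_nat_floor:
  fixes x :: real
  assumes "0 \<le> x"
  shows "real (nat \<lfloor>x\<rfloor>) \<le> x" "x < real (nat \<lfloor>x\<rfloor>) + 1"
proof -
  have "real (nat \<lfloor>x\<rfloor>) = real_of_int \<lfloor>x\<rfloor>" using assms by simp
  then show "real (nat \<lfloor>x\<rfloor>) \<le> x" "x < real (nat \<lfloor>x\<rfloor>) + 1" by simp_all
qed

text \<open>\<open>lm\<close> stands for the logarithm of the size bound. \<open>X\<close> is both
  the number of blocks and, up to the constant \<open>\<kappa> / 4096\<close>, the exponent over
  \<open>s\<close> that is forced.\<close>

lemma hard_parameters: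
  fixes \<kappa> lm X :: real and n k :: nat
  assumes \<kappa>: "0 < \<kappa>" "\<kappa> \<le> 1 / 2" and k: "1 \<le> k" and ll: "1 \<le> log 2 lm" and lm0: "0 < lm"
  defines "X \<equiv> lm powr (1 / 4) / log 2 lm ^ k"
  assumes X: "2000 / \<kappa>\<^sup>2 \<le> X" "4096 / \<kappa> * (1 + log 2 (2 / \<kappa>)) \<le> X" and n: "lm * X \<le> real n"
  shows "\<exists>w m B d :: nat. 1 \<le> w \<and> odd m \<and> 3 \<le> m \<and> 1 \<le> B \<and> 1 \<le> d \<and>
    128 * real d \<le> \<kappa> * (real B * real m) \<and>
    2 * 2 ^ w * real w + real B * real m \<le> real n \<and> 2 * 2 ^ w * real w + real m \<le> lm \<and>
    128 * sqrt m + 1 \<le> 2 ^ w / (2 * real B) \<and>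
    1 / 2 ^ w \<le> \<kappa> / 4 \<and> 4 / real B + 2 / 2 ^ w \<le> \<kappa>\<^sup>2 / 16 \<and>
    2 powr (\<kappa> / 4096 * (lm * X)) \<le> \<kappa> / 2 * 2 ^ d"
proof -
  define L where "L = log 2 lm"
  define y where "y = lm powr (1 / 4)"
  have \<kappa>2: "\<kappa>\<^sup>2 \<le> 1 / 4" "0 < \<kappa>\<^sup>2" "\<kappa>\<^sup>2 \<le> \<kappa>"
    using \<kappa> power_mono[of \<kappa> "1 / 2" 2] mult_left_mono[of \<kappa> 1 \<kappa>] by (auto simp: power2_eq_square)
  have X8: "8000 \<le> X"
  proof -
    have "8000 \<le> 2000 / \<kappa>\<^sup>2" using \<kappa>2 by (simp add: field_simps)
    then show ?thesis using X by linarith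
  qed
  have LP: "1 \<le> L" "L \<le> L ^ k"
    using ll k power_increasing[of 1 k L] by (auto simp: L_def)
  have yX: "y = X * L ^ k" using LP by (simp add: X_def y_def L_def)
  have LXy: "L * X \<le> y"
  proof -
    have "X * L \<le> X * L ^ k" using LP X8 by (intro mult_left_mono) auto
    then show ?thesis unfolding yX by (simp add: mult.commute)
  qed
  have yX': "X \<le> y"
  proof -
    have "1 * X \<le> L * X" using LP X8 by (intro mult_right_mono) auto
    then show ?thesis using LXy by linarith
  qed
  have y4: "lm = y ^ 4" "sqrt lm = y\<^sup>2"
  proof -
    show "lm = y ^ 4" using lm0 by (simp add: y_def powr_realpow[symmetric] powr_powr)
    then have "lm = (y\<^sup>2)\<^sup>2" by simp
    then show "sqrt lm = y\<^sup>2" by (simp only: real_sqrt_abs abs_power2)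
  qed
  have y1: "8000 \<le> y" using yX' X8 by simp
  have y3: "1 \<le> y ^ 3" using y1 by simp
  have lmy: "y \<le> lm"
    using mult_left_mono[OF y3, of y] y1 unfolding y4(1) by (simp add: power_eq_if)
  have lmL: "X \<le> lm / L"
  proof -
    have "L * X \<le> lm" using LXy lmy by linarith
    then show ?thesis using LP by (simp add: field_simps)
  qed
  \<comment> \<open>The divisor \<open>8 * L\<close> keeps \<open>2 * 2 ^ w * w\<close>, which
    bounds the number of term variables, below \<open>lm / 4\<close>.\<close>
  define v where "v = lm / (8 * L)"
  have vX: "X / 8 \<le> v" using lmL by (simp add: v_def field_simps)
  have v2: "2 \<le> v" using vX X8 by simp
  have vlm: "v \<le> lm" using LP lm0 by (simp add: v_def field_simps)
  define w where "w = nat \<lfloor>log 2 v\<rfloor>"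
  have lv: "1 \<le> log 2 v" using v2 by (simp add: le_log_iff)
  have wv: "real w \<le> log 2 v" "log 2 v < real w + 1"
    using real_nat_floor[of "log 2 v"] lv by (auto simp: w_def)
  have w1: "1 \<le> w" using lv by (simp add: w_def le_nat_iff le_floor_iff)
  have w_le: "2 ^ w \<le> v"
    using powr_mono[OF wv(1), of 2] v2 by (simp add: powr_realpow)
  have w_ge: "v \<le> 2 * 2 ^ w"
    using powr_mono[of "log 2 v" "real w + 1" 2] wv v2 by (simp add: powr_add powr_realpow)
  have wL: "real w \<le> L"
  proof -
    have "log 2 v \<le> log 2 lm" using v2 vlm by simp
    then show ?thesis using wv by (simp add: L_def)
  qed
  have size_x: "2 * 2 ^ w * real w \<le> lm / 4"
  proof -
    have "2 * 2 ^ w * real w \<le> 2 * v * L" using w_le wL v2 by (intro mult_mono) auto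
    also have "\<dots> = lm / 4" using LP by (simp add: v_def)
    finally show ?thesis .
  qed
  have w_big: "125 / \<kappa>\<^sup>2 \<le> 2 ^ w" using w_ge vX X(1) by simp
  then have w_small: "1 / 2 ^ w \<le> \<kappa>\<^sup>2 / 125" using \<kappa>2 by (simp add: field_simps)
  define a where "a = nat \<lfloor>lm / 8\<rfloor>"
  define m where "m = 2 * a + 1"
  have lm8: "8000 \<le> lm" using lmy y1 by linarith
  have a: "real a \<le> lm / 8" "lm / 8 < real a + 1"
    using real_nat_floor[of "lm / 8"] lm0 by (auto simp: a_def)
  have m: "real m \<le> lm / 2" "lm / 8 \<le> real m" using a lm8 by (auto simp: m_def)
  have m3: "3 \<le> m" using m lm8 by linarith
  \<comment> \<open>Up to constants, as many blocks as the assumption \<open>lm * X \<le> n\<close>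
    has variables for.\<close>
  define B where "B = nat \<lfloor>X\<rfloor>"
  have B: "real B \<le> X" "X / 2 \<le> real B" "1 \<le> B"
  proof -
    have "real B \<le> X" "X < real B + 1" using real_nat_floor[of X] X8 by (auto simp only: B_def)
    then show "real B \<le> X" "X / 2 \<le> real B" "1 \<le> B" using X8 by linarith+
  qed
  have Bm: "real B * real m \<le> lm * X / 2" "lm * X / 16 \<le> real B * real m"
  proof -
    have "real B * real m \<le> X * (lm / 2)" using B m X8 by (intro mult_mono) auto
    then show "real B * real m \<le> lm * X / 2" by (simp add: mult.commute)
    have "X / 2 * (lm / 8) \<le> real B * real m" using B m X8 lm0 by (intro mult_mono) auto
    then show "lm * X / 16 \<le> real B * real m" by (simp add: mult.commute)
  qed
  have lmX: "lm \<le> lm * X" "X \<le> lm * X"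
    using mult_left_mono[of 1 X lm] mult_right_mono[of 1 lm X] X8 lm8 by auto
  have tot: "2 * 2 ^ w * real w + real B * real m \<le> real n"
    using size_x Bm lmX n lm0 by linarith
  have gap: "128 * sqrt m + 1 \<le> 2 ^ w / (2 * real B)"
  proof -
    \<comment> \<open>With \<open>lm = y ^ 4\<close> the left side is at most
      \<open>129 * y\<^sup>2\<close> and the right side at least \<open>y ^ 3 / 32\<close>;
      \<open>y \<ge> 8000\<close> decides.\<close>
    have "sqrt m \<le> sqrt lm" using m lm0 by simp
    then have "128 * sqrt m + 1 \<le> 128 * y\<^sup>2 + 1 * 1" unfolding y4(2) by linarith
    also have "1 * 1 \<le> y * y" using y1 by (intro mult_mono) auto
    also have "128 * y\<^sup>2 + y * y = 129 * y\<^sup>2" by (simp add: power2_eq_square)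
    also have "\<dots> \<le> (y / 32) * y\<^sup>2" using y1 by (intro mult_right_mono) auto
    also have "\<dots> = y ^ 4 / (32 * y)" using y1 by (simp add: power_eq_if)
    also have "\<dots> \<le> lm / (32 * (L * X))"
      unfolding y4(1)[symmetric] using LXy LP X8 lm0 y1 by (intro divide_left_mono) auto
    also have "\<dots> = (v / 2) / (2 * X)" by (simp add: v_def)
    also have "\<dots> \<le> 2 ^ w / (2 * X)" using w_ge X8 by (intro divide_right_mono) auto
    also have "\<dots> \<le> 2 ^ w / (2 * real B)" using B X8 by (intro divide_left_mono) auto
    finally show ?thesis by simp
  qed
  have small1: "1 / 2 ^ w \<le> \<kappa> / 4" using w_small \<kappa>2 \<kappa> by linarith
  have small2: "4 / real B + 2 / 2 ^ w \<le> \<kappa>\<^sup>2 / 16"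
  proof -
    have "1000 / \<kappa>\<^sup>2 \<le> real B" using B X by simp
    then have "4 / real B \<le> \<kappa>\<^sup>2 / 250" using \<kappa>2 B by (simp add: field_simps)
    moreover have "2 / 2 ^ w \<le> 2 * (\<kappa>\<^sup>2 / 125)" using w_small by simp
    ultimately show ?thesis using \<kappa>2 by linarith
  qed
  \<comment> \<open>Here 4096 is 16 lost in \<open>B * m\<close>, times 128 lost in
    \<open>d\<close>, times 2: the second copy of \<open>Z\<close> pays for rounding
    \<open>d\<close> and for the factor \<open>\<kappa> / 2\<close>.\<close>
  define Z where "Z = \<kappa> / 4096 * (lm * X)"
  have Z: "1 + log 2 (2 / \<kappa>) \<le> Z"
  proof -
    have "1 + log 2 (2 / \<kappa>) \<le> \<kappa> / 4096 * X" using X(2) \<kappa> by (simp add: field_simps)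
    also have "\<dots> \<le> Z" unfolding Z_def using lmX \<kappa> by (intro mult_left_mono) auto
    finally show ?thesis .
  qed
  have l2: "1 \<le> log 2 (2 / \<kappa>)" using \<kappa> by (simp add: le_log_iff field_simps)
  define d where "d = nat \<lfloor>\<kappa> * (real B * real m) / 128\<rfloor>"
  have d: "real d \<le> \<kappa> * (real B * real m) / 128" "\<kappa> * (real B * real m) / 128 < real d + 1"
    using real_nat_floor[of "\<kappa> * (real B * real m) / 128"] \<kappa> by (auto simp: d_def)
  have "2 * Z \<le> \<kappa> * (real B * real m) / 128"
    using mult_left_mono[OF Bm(2), of "\<kappa> / 128"] \<kappa> by (simp add: Z_def)
  then have dZ: "2 * Z - 1 \<le> real d" using d by linarith
  have d1: "1 \<le> d" using dZ Z l2 by linarith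
  have "2 powr Z \<le> 2 powr (real d + log 2 (\<kappa> / 2))"
    using dZ Z \<kappa> by (intro powr_mono) (auto simp: log_divide)
  also have "\<dots> = \<kappa> / 2 * 2 ^ d" using \<kappa> by (simp add: powr_add powr_realpow)
  finally have fin: "2 powr Z \<le> \<kappa> / 2 * 2 ^ d" .
  have tot2: "2 * 2 ^ w * real w + real m \<le> lm" using size_x m lm0 by linarith
  have "odd m" by (simp add: m_def)
  then show ?thesis
    using w1 m3 B(3) d1 d(1) tot tot2 gap small1 small2 fin[unfolded Z_def]
    by (intro exI[of _ w] exI[of _ m] exI[of _ B] exI[of _ d] conjI) auto
qed

lemma X_at_top: "filterlim (\<lambda>x::real. x powr (1 / 4) / log 2 x ^ k) at_top at_top"
  by real_asymp

text \<open>Inverts a bound of order n^(4/5) on \<open>lm\<close> into one of order lm^(5/4) on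
  \<open>n\<close>. The difficulty is that the given logarithms are in \<open>n\<close> and must be
  replaced by logarithms in \<open>lm\<close>.\<close>

lemma soft_bound_inverse:
  fixes C lm :: real and n k :: nat
  assumes C: "0 < C" and n: "1 \<le> n" and lm: "0 < lm"
    and L: "1 \<le> log 2 lm" "(C * 2 ^ k) powr (5 / 4) \<le> log 2 lm"
    and le: "lm \<le> C * real n powr (4 / 5) * log 2 (real n powr (4 / 5)) ^ k"
  shows "lm * (lm powr (1 / 4) / log 2 lm ^ (2 * k + 2)) \<le> real n"
proof -
  define l where "l = log 2 lm"
  have l1: "1 \<le> l" using L by (simp add: l_def)
  have lm2: "2 \<le> lm" using L(1) lm by (simp add: le_log_iff)
  have lp: "1 \<le> l ^ i" for i using l1 by simp
  have "lm powr (5 / 4) \<le> real n * l ^ (2 * k + 2)"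
  \<comment> \<open>If \<open>n\<close> is at least \<open>lm\<^sup>2\<close> the claim is
    immediate; otherwise \<open>log 2 n\<close> is at most twice \<open>log 2 lm\<close>.\<close>
  proof (cases "lm\<^sup>2 \<le> real n")
    case True
    have "lm powr (5 / 4) \<le> lm powr 2" using lm2 by (intro powr_mono) auto
    also have "\<dots> \<le> real n" using True lm by simp
    also have "\<dots> \<le> real n * l ^ (2 * k + 2)"
    proof -
      have "real n * 1 \<le> real n * l ^ (2 * k + 2)" by (intro mult_left_mono lp) simp
      then show ?thesis by linarith
    qed
    finally show ?thesis .
  next
    case False
    define g where "g = real n powr (4 / 5)"
    have g0: "0 \<le> g" by (simp add: g_def)
    have "log 2 (real n) \<le> log 2 (lm\<^sup>2)" using False n lm by simp
    then have "log 2 (real n) \<le> 2 * l" using lm by (simp add: log_nat_power l_def)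
    moreover have "0 \<le> log 2 (real n)" using n by simp
    ultimately have lg: "0 \<le> log 2 g" "log 2 g \<le> 2 * l" using n l1 by (auto simp: g_def log_powr)
    have "lm \<le> C * g * log 2 g ^ k" using le by (simp add: g_def)
    also have "\<dots> \<le> C * g * (2 * l) ^ k"
      using lg C g0 by (intro mult_left_mono power_mono) auto
    also have "\<dots> = (C * 2 ^ k) * g * l ^ k" by (simp add: power_mult_distrib)
    finally have "lm powr (5 / 4) \<le> ((C * 2 ^ k) * g * l ^ k) powr (5 / 4)"
      using lm by (intro powr_mono2) auto
    also have "\<dots> = (C * 2 ^ k) powr (5 / 4) * g powr (5 / 4) * (l ^ k) powr (5 / 4)"
      using C g0 l1 by (simp add: powr_mult)
    also have "g powr (5 / 4) = real n" using n by (simp add: g_def powr_powr)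
    \<comment> \<open>One part of \<open>l ^ (2 * k + 2)\<close> absorbs the constant, the other
      rounds the exponent \<open>5 * k / 4\<close> up to \<open>2 * k\<close>.\<close>
    also have "(C * 2 ^ k) powr (5 / 4) * real n * (l ^ k) powr (5 / 4) \<le> l\<^sup>2 * real n * l ^ (2 * k)"
    proof (intro mult_mono)
      have "l \<le> l\<^sup>2" using l1 by (simp add: power2_eq_square)
      then show "(C * 2 ^ k) powr (5 / 4) \<le> l\<^sup>2" using L(2) by (simp add: l_def)
      have "(l ^ k) powr (5 / 4) \<le> (l ^ k) powr 2" using lp[of k] by (intro powr_mono) auto
      also have "\<dots> = l ^ (2 * k)" using lp[of k] by (simp add: power_mult[symmetric] mult.commute)
      finally show "(l ^ k) powr (5 / 4) \<le> l ^ (2 * k)" .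
    qed auto
    also have "\<dots> = real n * l ^ (2 * k + 2)" by (simp add: power_add power2_eq_square)
    finally show ?thesis .
  qed
  moreover have "lm powr (5 / 4) = lm * lm powr (1 / 4)"
    using lm powr_add[of lm 1 "1 / 4"] by simp
  moreover have "0 < l ^ (2 * k + 2)" using l1 by simp
  ultimately show ?thesis by (simp add: l_def divide_le_eq)
qed

theorem theorem2p6:
  fixes \<epsilon> :: real and s :: "nat \<Rightarrow> nat"
  assumes "0 < \<epsilon>" and "\<epsilon> < 1/2"
    and "\<And>n. s n \<ge> 1"
    and "\<exists>h \<in> soft_O (\<lambda>n. real n powr (4/5)). \<forall>n. real (s n) \<le> 2 powr h n"
  shows "\<exists>e \<in> soft_Omega (\<lambda>t. (log 2 (real t)) powr (1/4)).
           \<forall>n. \<exists>f. sign_valued n f \<and> monotone_fun n f \<and> computable_with_size n f (s n) \<and>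
             (\<forall>G T. impurity_function G \<longrightarrow> builds G \<epsilon> n f T \<longrightarrow>
                real (tree_size T) \<ge> real (s n) powr e (s n))"
proof -
  obtain h C k where C: "0 < C"
    and ev: "eventually (\<lambda>n. h n \<le> C * real n powr (4/5) * (log 2 (real n powr (4/5))) ^ k) at_top"
    and sh: "\<And>n. real (s n) \<le> 2 powr h n"
    using assms(4) unfolding soft_O_def by blast
  obtain n0 where n0: "\<And>n. n0 \<le> n \<Longrightarrow> h n \<le> C * real n powr (4/5) * (log 2 (real n powr (4/5))) ^ k"
    using ev unfolding eventually_at_top_linorder by blast
  define \<kappa> where "\<kappa> = 1 / 2 - \<epsilon>"
  have \<kappa>: "0 < \<kappa>" "\<kappa> \<le> 1 / 2" using assms by (auto simp: \<kappa>_def)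
  define K where "K = 2 * k + 2"
  define X where "X = (\<lambda>x::real. x powr (1 / 4) / log 2 x ^ K)"
  have Xlim: "filterlim X at_top at_top" unfolding X_def by (rule X_at_top)
  have llim: "filterlim (\<lambda>x::real. log 2 x) at_top at_top" by real_asymp
  have "eventually (\<lambda>x. 2000 / \<kappa>\<^sup>2 \<le> X x \<and> 4096 / \<kappa> * (1 + log 2 (2 / \<kappa>)) \<le> X x \<and>
      1 \<le> log 2 x \<and> (C * 2 ^ k) powr (5 / 4) \<le> log 2 x \<and> 0 < x) at_top"
    using Xlim llim unfolding filterlim_at_top by (intro eventually_conj eventually_gt_at_top) auto
  then obtain x0 where x0: "\<And>x. x0 \<le> x \<Longrightarrow> 2000 / \<kappa>\<^sup>2 \<le> X x"
    "\<And>x. x0 \<le> x \<Longrightarrow> 4096 / \<kappa> * (1 + log 2 (2 / \<kappa>)) \<le> X x"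
    "\<And>x. x0 \<le> x \<Longrightarrow> 1 \<le> log 2 x" "\<And>x. x0 \<le> x \<Longrightarrow> (C * 2 ^ k) powr (5 / 4) \<le> log 2 x"
    "\<And>x. x0 \<le> x \<Longrightarrow> 0 < x"
    unfolding eventually_at_top_linorder by blast
  \<comment> \<open>As \<open>s\<close> need not be monotone, adding all \<open>s n\<close> with
    \<open>n \<le> n0\<close> is what makes \<open>t0 \<le> s n\<close> force \<open>n0 < n\<close>;
    the summand from \<open>2 powr x0\<close> makes \<open>log 2 (s n)\<close> at least
    \<open>x0\<close>.\<close>
  define t0 where "t0 = nat \<lceil>2 powr x0\<rceil> + (\<Sum>n\<le>n0. s n) + 1"
  \<comment> \<open>The factor \<open>4 ^ K\<close> compensates for \<open>log 2 (g t)\<close> being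
    a quarter of the iterated logarithm of \<open>t\<close>.\<close>
  define c where "c = \<kappa> / 4096 / 4 ^ K"
  define g where "g = (\<lambda>t::nat. (log 2 (real t)) powr (1/4))"
  \<comment> \<open>Below the threshold the exponent 0 asks only for size 1, which a constant
    function meets.\<close>
  define e where "e = (\<lambda>t::nat. if t0 \<le> t then c * g t / (log 2 (g t)) ^ K else 0)"
  have "0 < c" using \<kappa> by (simp add: c_def)
  moreover have "eventually (\<lambda>t. e t \<ge> c * g t / (log 2 (g t)) ^ K) at_top"
    using eventually_ge_at_top[of t0] by eventually_elim (simp add: e_def)
  ultimately have "e \<in> soft_Omega (\<lambda>t. (log 2 (real t)) powr (1/4))"
    unfolding soft_Omega_def g_def by blast
  moreover have "\<exists>f. sign_valued n f \<and> monotone_fun n f \<and> computable_with_size n f (s n) \<and>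
      (\<forall>G T. impurity_function G \<longrightarrow> builds G \<epsilon> n f T \<longrightarrow> real (tree_size T) \<ge> real (s n) powr e (s n))" for n
  proof (cases "t0 \<le> s n")
    case False
    have "computable_with_size n (\<lambda>_. 1) (s n)"
      unfolding computable_with_size_def using assms(3)[of n] by (intro exI[of _ "Leaf 1"]) auto
    moreover have "real (s n) powr e (s n) \<le> real (tree_size T)" for T :: "real dtree"
      using False assms(3)[of n] tree_size_pos[of T] by (simp add: e_def)
    ultimately show ?thesis
      by (intro exI[of _ "\<lambda>_. 1"]) (auto simp: sign_valued_def monotone_fun_def)
  next
    case True
    define lm where "lm = log 2 (real (s n))"
    have s1: "1 \<le> s n" by (rule assms(3))
    have n0n: "n0 < n"
    proof (rule ccontr)
      assume "\<not> n0 < n"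
      then have "s n \<le> (\<Sum>n\<le>n0. s n)" by (intro member_le_sum) auto
      then show False using True by (simp add: t0_def)
    qed
    have "2 powr x0 \<le> real t0" unfolding t0_def by linarith
    also have "\<dots> \<le> real (s n)" using True by simp
    finally have lmx: "x0 \<le> lm" using s1 by (simp add: lm_def le_log_iff)
    note x = x0[OF lmx]
    have "lm \<le> h n" using sh[of n] s1 by (simp add: lm_def log_le_iff)
    then have "lm * X lm \<le> real n"
      unfolding X_def K_def using n0[of n] n0n x by (intro soft_bound_inverse[OF C]) auto
    then obtain w m B d where par: "1 \<le> w" "odd m" "3 \<le> m" "1 \<le> B" "1 \<le> d"
      "128 * real d \<le> \<kappa> * (real B * real m)"
      "2 * 2 ^ w * real w + real B * real m \<le> real n" "2 * 2 ^ w * real w + real m \<le> lm"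
      "128 * sqrt m + 1 \<le> 2 ^ w / (2 * real B)"
      "1 / 2 ^ w \<le> \<kappa> / 4" "4 / real B + 2 / 2 ^ w \<le> \<kappa>\<^sup>2 / 16"
      and size: "2 powr (\<kappa> / 4096 * (lm * X lm)) \<le> \<kappa> / 2 * 2 ^ d"
      using hard_parameters[OF \<kappa>, of K lm n] x unfolding X_def K_def by auto
    have "log 2 (g (s n)) = log 2 lm / 4"
      using x(5) by (simp add: g_def lm_def log_powr)
    then have "e (s n) = c * g (s n) / (log 2 lm / 4) ^ K"
      using True by (simp only: e_def if_True)
    also have "\<dots> = \<kappa> / 4096 * X lm"
      by (simp add: c_def X_def g_def lm_def power_divide)
    finally have "e (s n) = \<kappa> / 4096 * X lm" .
    moreover have "real (s n) = 2 powr lm" using s1 by (simp add: lm_def)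
    ultimately have "real (s n) powr e (s n) = 2 powr (lm * (\<kappa> / 4096 * X lm))"
      by (simp only: powr_powr)
    also have "\<dots> = 2 powr (\<kappa> / 4096 * (lm * X lm))"
      by (simp only: mult.left_commute)
    also have "\<dots> \<le> \<kappa> / 2 * 2 ^ d" by (rule size)
    finally have "real (s n) powr e (s n) \<le> \<kappa> / 2 * 2 ^ d" .
    moreover have "\<exists>f. sign_valued n f \<and> monotone_fun n f \<and> computable_with_size n f (s n) \<and>
        (\<forall>G T. impurity_function G \<longrightarrow> builds G \<epsilon> n f T \<longrightarrow> \<kappa> / 2 * 2 ^ d \<le> tree_size T)"
      using hard_function[OF assms(1,2), folded \<kappa>_def, OF par(1-7) s1 par(8)[unfolded lm_def] par(9-11)] .
    ultimately show ?thesis by (meson order_trans)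
  qed
  ultimately show ?thesis by blast
qed

end
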